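(* Assume that $\mathbf X$ is distributed on $[0,1]^d$ and consider a totally non adaptive forest of level $k=k_n$. In addition, assume that for all $\rho,\varepsilon>0$, there exists $N>0$ such that, with probability at least $1-\rho$, for all $n>N$, $$\mathrm{diam}(A_n(\mathbf X,\Theta))\le\varepsilon.$$ Then, provided $k\to\infty$ and $2^k/n\to0$ as $n\to\infty$, the infinite random forest is $\mathbb{L}^2$ consistent, that is, $R(m_{\infty,n})\to0$ as $n\to\infty$.
   Context: Data: $\mathcal{D}_n=((\mathbf X_1,Y_1),\dots,(\mathbf X_n,Y_n))$ is a sample of independent $[0,1]^d\times\mathbb{R}$-valued random variables distributed as $(\mathbf X,Y)$ with $\mathbb{E}[Y^2]<\infty$; $\mathbf X$ denotes also a fresh copy independent of $\mathcal D_n$, and $m(\mathbf x)=\mathbb{E}[Y\mid\mathbf X=\mathbf x]$. Random forest: $\Theta$ is a random variable independent of $\mathcal{D}_n$ and $\mathbf X$. A tree is a partition of $[0,1]^d$ into axis-parallel hyperrectangular cells, obtained by successive axis-parallel binary cuts starting from $[0,1]^d$. A forest is totally non adaptive of level $k$ ($k\in\mathbb{N}$, possibly depending on $n$) if each tree is built independently of the training set (i.e. from the random parameter $\Theta$ only) and each cell is cut exactly $k$ times (so the tree is a full binary tree of depth $k$, with $2^k$ leaf cells). $A_n(\mathbf X,\Theta)$ is the resulting (leaf) cell containing $\mathbf X$ in the tree designed with $\Theta$, and $\mathrm{diam}$ is its diameter. With $N_n(\mathbf x,\Theta)$ the number of $\mathbf X_i$, $1\le i\le n$, in $A_n(\mathbf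 x,\Theta)$, the tree estimate is $m_n(\mathbf x,\Theta)=\sum_{i=1}^nY_i\,\mathbf 1_{\mathbf X_i\in A_n(\mathbf x,\Theta)}/N_n(\mathbf x,\Theta)$ (with $0/0=0$), and the infinite forest estimate is $m_{\infty,n}(\mathbf x)=\mathbb{E}_\Theta[m_n(\mathbf x,\Theta)]$, the expectation being with respect to $\Theta$ conditionally on $\mathcal{D}_n$. The risk is $R(m_{\infty,n})=\mathbb{E}[m_{\infty,n}(\mathbf X)-m(\mathbf X)]^2$, expectation over $\mathbf X$ and $\mathcal{D}_n$. *)

theory Defs
  imports "HOL-Probability.Probability"
begin

section \<open>Trees of axis-parallel cuts\<close>

text \<open>
  A node labelled \<open>(j, s)\<close> cuts its cell along coordinate \<open>j\<close> at position \<open>s\<close>. The boundary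
  hyperplane is given to the upper child, so that the children partition the cell.
\<close>

type_synonym 'd cut_tree = "('d \<times> real) tree"

definition lower_part :: "'d::finite \<times> real \<Rightarrow> (real ^ 'd) set \<Rightarrow> (real ^ 'd) set" where
  "lower_part c A = {z \<in> A. z $ fst c < snd c}"

definition upper_part :: "'d::finite \<times> real \<Rightarrow> (real ^ 'd) set \<Rightarrow> (real ^ 'd) set" where
  "upper_part c A = {z \<in> A. snd c \<le> z $ fst c}"

text \<open>Every cut is a genuine one: it leaves points of the cell on both sides.\<close>

primrec proper_cuts :: "(real ^ 'd::finite) set \<Rightarrow> 'd cut_tree \<Rightarrow> bool" where
  "proper_cuts A Leaf = True"
| "proper_cuts A (Node l c r) =
     (lower_part c A \<noteq> {} \<and> upper_part c A \<noteq> {} \<and>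
      proper_cuts (lower_part c A) l \<and> proper_cuts (upper_part c A) r)"

primrec leaf_cell_from :: "(real ^ 'd::finite) set \<Rightarrow> 'd cut_tree \<Rightarrow> real ^ 'd \<Rightarrow> (real ^ 'd) set" where
  "leaf_cell_from A Leaf x = A"
| "leaf_cell_from A (Node l c r) x =
     (if x $ fst c < snd c then leaf_cell_from (lower_part c A) l x
      else leaf_cell_from (upper_part c A) r x)"

text \<open>Meaningful for \<open>x\<close> in the unit cube only, where the result contains \<open>x\<close>.\<close>

definition leaf_cell :: "'d::finite cut_tree \<Rightarrow> real ^ 'd \<Rightarrow> (real ^ 'd) set" where
  "leaf_cell t x = leaf_cell_from (cbox 0 1) t x"

definition cut_tree_space :: "'d::finite cut_tree measure" where
  "cut_tree_space = tree_sigma (count_space UNIV \<Otimes>\<^sub>M borel)"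

text \<open>
  The trees \<open>T n \<theta>\<close> depend on the random parameter \<open>\<theta>\<close> only, not on the training set;
  \<open>N\<close> is the measurable space in which the parameter takes its values.
\<close>

definition totally_non_adaptive ::
    "'t measure \<Rightarrow> (nat \<Rightarrow> 't \<Rightarrow> 'd::finite cut_tree) \<Rightarrow> (nat \<Rightarrow> nat) \<Rightarrow> bool" where
  "totally_non_adaptive N T k \<longleftrightarrow>
     (\<forall>n. T n \<in> measurable N cut_tree_space \<and>
          (\<forall>\<theta>\<in>space N. Tree.complete (T n \<theta>) \<and> height (T n \<theta>) = k n \<and> proper_cuts (cbox 0 1) (T n \<theta>)))"

section \<open>Estimates and risk\<close>

text \<open>
  A sample of size \<open>n\<close> consists of the first \<open>n\<close> terms of a sequence of pairs, indexed from \<open>0\<close>.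
  The convention \<open>0/0 = 0\<close> is that of division in HOL.
\<close>

definition tree_estimate ::
    "nat \<Rightarrow> 'd::finite cut_tree \<Rightarrow> (nat \<Rightarrow> (real ^ 'd) \<times> real) \<Rightarrow> real ^ 'd \<Rightarrow> real" where
  "tree_estimate n t D x =
     (\<Sum>i<n. snd (D i) * indicator (leaf_cell t x) (fst (D i))) /
     real (card {i. i < n \<and> fst (D i) \<in> leaf_cell t x})"

text \<open>
  The expectation is over \<open>\<Theta>\<close> alone, the sample \<open>D\<close> being held fixed. As \<open>\<Theta>\<close> is independent of the
  sample, this is the conditional expectation given the sample. The integrand is bounded in \<open>\<omega>\<close>.
\<close>

definition infinite_forest_estimate ::
    "'w measure \<Rightarrow> ('w \<Rightarrow> 't) \<Rightarrow> (nat \<Rightarrow> 't \<Rightarrow> 'd::finite cut_tree) \<Rightarrow>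
     nat \<Rightarrow> (nat \<Rightarrow> (real ^ 'd) \<times> real) \<Rightarrow> real ^ 'd \<Rightarrow> real" where
  "infinite_forest_estimate M \<Theta> T n D x = (\<integral>\<omega>. tree_estimate n (T n (\<Theta> \<omega>)) D x \<partial>M)"

text \<open>A version \<open>m\<close> of the regression function \<open>x \<mapsto> E[Y | X = x]\<close>.\<close>

definition regression_function ::
    "'w measure \<Rightarrow> ('w \<Rightarrow> real ^ 'd::finite) \<Rightarrow> ('w \<Rightarrow> real) \<Rightarrow> (real ^ 'd \<Rightarrow> real) \<Rightarrow> bool" where
  "regression_function M X Y m \<longleftrightarrow>
     m \<in> borel_measurable borel \<and>
     (AE \<omega> in M. real_cond_exp M (vimage_algebra (space M) X borel) Y \<omega> = m (X \<omega>))"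

text \<open>
  An extended nonnegative expectation, so that a non-integrable square would give \<open>\<infinity>\<close> rather
  than the default value \<open>0\<close> of the Bochner integral.
\<close>

definition forest_risk ::
    "'w measure \<Rightarrow> ('w \<Rightarrow> 't) \<Rightarrow> (nat \<Rightarrow> 't \<Rightarrow> 'd::finite cut_tree) \<Rightarrow>
     (nat \<Rightarrow> 'w \<Rightarrow> (real ^ 'd) \<times> real) \<Rightarrow> ('w \<Rightarrow> real ^ 'd) \<Rightarrow> (real ^ 'd \<Rightarrow> real) \<Rightarrow>
     nat \<Rightarrow> ennreal" where
  "forest_risk M \<Theta> T Z X m n =
     (\<integral>\<^sup>+\<omega>. ennreal ((infinite_forest_estimate M \<Theta> T n (\<lambda>i. Z i \<omega>) (X \<omega>) - m (X \<omega>))\<^sup>2) \<partial>M)"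

section \<open>Independence\<close>

text \<open>
  Mutual independence of all \<open>Z i\<close>, \<open>X\<close> and \<open>\<Theta>\<close>. They have different types, hence
  \<open>indep_vars\<close> does not apply and independence is stated for the generated \<open>\<sigma>\<close>-algebras.
\<close>

datatype source = Observation nat | Query | Parameter

definition independent_sources ::
    "'w measure \<Rightarrow> (nat \<Rightarrow> 'w \<Rightarrow> (real ^ 'd::finite) \<times> real) \<Rightarrow> ('w \<Rightarrow> real ^ 'd) \<Rightarrow>
     't measure \<Rightarrow> ('w \<Rightarrow> 't) \<Rightarrow> bool" where
  "independent_sources M Z X N \<Theta> \<longleftrightarrow>
     prob_space.indep_sets M
       (case_source (\<lambda>i. {Z i -` B \<inter> space M | B. B \<in> sets borel})
                    {X -` B \<inter> space M | B. B \<in> sets borel}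
                    {\<Theta> -` B \<inter> space M | B. B \<in> sets N})
       UNIV"

end

theory Submission
  imports Defs
begin

text \<open>
  By Jensen's inequality and independence the risk of the forest is at most
  \<open>E (m\<^sub>n(X, \<Theta>) - m(X))\<^sup>2\<close>, the mean risk of one tree. A fixed tree of level \<open>k\<close> only acts through the
  label (the path to the leaf) of each point, and there are \<open>2\<^sup>k\<close> labels. As the law of the sample
  extended by the query is exchangeable, averaging over the position of the query shows that the
  expected inverse size of its cell is at most \<open>2\<^sup>k / (n + 1)\<close> and that the tree average of a nonnegative
  function \<open>h\<close> of the data has expectation at most \<open>2 E h\<close>.

  Approximate \<open>m\<close> in \<open>L\<^sup>2\<close> by a bounded continuous \<open>g\<close>. The error of the tree splits into the average of the
  noise \<open>Y\<^sub>i - m(X\<^sub>i)\<close> (uncorrelated terms, so only the sum of the squared weights matters), the average of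
  \<open>m - g\<close>, the oscillation of \<open>g\<close> on the cell of \<open>X\<close> (small where the diameter is), the event that the cell
  is empty, and \<open>g(X) - m(X)\<close>.
\<close>

section \<open>Weights of a random partition\<close>

text \<open>\<open>Y\<close> is only square integrable, so neither the conditional variance of the
  noise nor \<open>m\<close> need be bounded; each gets a truncation with a level of its own. What
  stands in for boundedness is exchangeability, and it dictates the form of the bounds. The estimate
  divides by the number c of observations in the cell of the query, but only the count c + 1 that
  includes the query is symmetric in all n + 1 points. As c + 1 \<le> 2 c when c > 0, the change of
  denominator costs the factor 2 that appears throughout. The tree may depend on \<Theta> in any
  measurable way. Paths instead of cells give bounds that involve only the number of labels. These
  are uniform in the tree, so \<Theta> can be integrated out last, whatever its law. The geometry of
  the cells enters at a single point, where the diameter is compared with the modulus of continuity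
  of \<open>g\<close>.\<close>

definition hits :: "nat set \<Rightarrow> (nat \<Rightarrow> 'c) \<Rightarrow> nat \<Rightarrow> real" where
  "hits I l i = (\<Sum>j\<in>I. of_bool (l j = l i))"

text \<open>Position \<open>n\<close> is the query, the positions below \<open>n\<close> are the
  observations. On an empty class division by 0 makes all weights 0, in agreement with the
  convention 0/0 = 0 of the estimate.\<close>

definition weight :: "nat \<Rightarrow> (nat \<Rightarrow> 'c) \<Rightarrow> nat \<Rightarrow> real" where
  "weight n l i = of_bool (l i = l n) / hits {..<n} l n"

lemma hits_eq_card: "finite I \<Longrightarrow> hits I l i = real (card {j \<in> I. l j = l i})"
  unfolding hits_def by (simp add: of_bool_def sum.If_cases Int_def)

lemma hits_nonneg [simp]: "0 \<le> hits I l i"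
  unfolding hits_def by (intro sum_nonneg) simp

lemma hits_ge_1: "finite I \<Longrightarrow> j \<in> I \<Longrightarrow> l j = l i \<Longrightarrow> 1 \<le> hits I l i"
  unfolding hits_def by (rule order_trans[OF _ member_le_sum[of j]]) auto

lemma hits_atMost_self: "hits {..n} l n = hits {..<n} l n + 1"
  by (simp add: hits_def lessThan_Suc_atMost[symmetric])

lemma hits_lessThan_cases: "hits {..<n} l n = 0 \<or> 1 \<le> hits {..<n} l n"
  by (simp add: hits_eq_card del: of_nat_eq_0_iff) linarith

lemma weight_nonneg [simp]: "0 \<le> weight n l i"
  by (simp add: weight_def)

lemma weight_le_1: "weight n l i \<le> 1"
  using hits_lessThan_cases[of n l] by (auto simp: weight_def of_bool_def divide_le_eq_1)

lemma sum_weight: "(\<Sum>i<n. weight n l i) = of_bool (hits {..<n} l n \<noteq> 0)"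
  by (simp add: weight_def sum_divide_distrib[symmetric] hits_def[symmetric])

text \<open>A class with c \<ge> 1 observations has c + 1 \<le> 2 c members once the query is
  counted. The new denominator no longer distinguishes the query from the observations.\<close>

lemma weight_le: "weight n l i \<le> 2 * (of_bool (l i = l n) / hits {..n} l n)"
  using hits_lessThan_cases[of n l]
  by (auto simp: weight_def hits_atMost_self field_simps)

text \<open>The left side is 1 exactly when no observation shares the label of the query. The query
  is then alone in its class, and the right side is 1 too.\<close>

lemma one_minus_sum_weight_le: "1 - (\<Sum>i<n. weight n l i) \<le> 1 / hits {..n} l n"
  by (auto simp: sum_weight hits_atMost_self)

text \<open>On a class with c \<ge> 1 observations the weights are c copies of 1/c, so their squares
  add up to 1/c \<le> 2/(c + 1).\<close>

lemma sum_weight_square_le: "(\<Sum>i<n. (weight n l i)\<^sup>2) \<le> 2 / hits {..n} l n"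
proof -
  have "(\<Sum>i<n. (weight n l i)\<^sup>2) = (\<Sum>i<n. weight n l i / hits {..<n} l n)"
    by (intro sum.cong) (auto simp: weight_def power2_eq_square)
  also have "\<dots> = of_bool (hits {..<n} l n \<noteq> 0) / hits {..<n} l n"
    by (simp add: sum_divide_distrib[symmetric] sum_weight)
  also have "\<dots> \<le> 2 / hits {..n} l n"
    using hits_lessThan_cases[of n l] by (auto simp: hits_atMost_self field_simps)
  finally show ?thesis .
qed

text \<open>Each occupied class contributes its size times the inverse of its size, hence 1.\<close>

lemma sum_inverse_hits:
  assumes "finite I"
  shows "(\<Sum>i\<in>I. 1 / hits I l i) = real (card (l ` I))"
proof -
  have "(\<Sum>i\<in>I. 1 / hits I l i) = (\<Sum>c\<in>l ` I. \<Sum>i\<in>{i \<in> I. l i = c}. 1 / hits I l i)"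
    by (rule sum.image_gen[OF assms])
  also have "\<dots> = (\<Sum>c\<in>l ` I. 1)"
  proof (rule sum.cong[OF refl])
    fix c assume "c \<in> l ` I"
    then have "{i \<in> I. l i = c} \<noteq> {}" by auto
    then have *: "card {i \<in> I. l i = c} \<noteq> 0" using assms by simp
    have "(\<Sum>i\<in>{i \<in> I. l i = c}. 1 / hits I l i) = (\<Sum>i\<in>{i \<in> I. l i = c}. 1 / real (card {i \<in> I. l i = c}))"
      by (intro sum.cong) (auto simp: hits_eq_card assms)
    also have "\<dots> = 1" using * by simp
    finally show "(\<Sum>i\<in>{i \<in> I. l i = c}. 1 / hits I l i) = 1" .
  qed
  finally show ?thesis by simp
qed

text \<open>Jensen's inequality for the square, read off from a nonnegative variance. The weights
  sum to 1 or are all 0; in the latter case both sides vanish.\<close>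

lemma weighted_mean_square_le:
  "(\<Sum>i<n. weight n l i * a i)\<^sup>2 \<le> (\<Sum>i<n. weight n l i * (a i)\<^sup>2)"
proof (cases "hits {..<n} l n = 0")
  case True
  then show ?thesis by (simp add: weight_def)
next
  case False
  then have *: "sum (weight n l) {..<n} = 1" by (simp add: sum_weight)
  define b where "b = (\<Sum>i<n. weight n l i * a i)"
  have "0 \<le> (\<Sum>i<n. weight n l i * (a i - b)\<^sup>2)" by (intro sum_nonneg) simp
  also have "\<dots> = (\<Sum>i<n. weight n l i * (a i)\<^sup>2 - 2 * b * (weight n l i * a i) + b\<^sup>2 * weight n l i)"
    by (intro sum.cong) (auto simp: power2_eq_square algebra_simps)
  also have "\<dots> = (\<Sum>i<n. weight n l i * (a i)\<^sup>2) - b\<^sup>2"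
    by (simp add: sum.distrib sum_subtractf sum_distrib_left[symmetric] * b_def[symmetric])
       (simp add: power2_eq_square)
  finally show ?thesis by (simp add: b_def)
qed

lemma measurable_count_space_eq:
  fixes f g :: "'a \<Rightarrow> 'c::countable"
  assumes [measurable]: "f \<in> measurable M (count_space UNIV)" "g \<in> measurable M (count_space UNIV)"
  shows "Measurable.pred M (\<lambda>x. f x = g x)"
proof -
  have "(\<lambda>x. f x = g x) = (\<lambda>x. \<exists>c. f x = c \<and> g x = c)" by auto
  also have "Measurable.pred M \<dots>" by measurable
  finally show ?thesis .
qed

lemma measurable_hits:
  fixes l :: "'a \<Rightarrow> nat \<Rightarrow> 'c::countable"
  assumes "\<And>j. j \<in> I \<Longrightarrow> (\<lambda>x. l x j) \<in> measurable M (count_space UNIV)"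
    and "(\<lambda>x. l x i) \<in> measurable M (count_space UNIV)"
  shows "(\<lambda>x. hits I (l x) i) \<in> borel_measurable M"
proof -
  have "(\<lambda>x. of_bool (l x j = l x i) :: real) \<in> borel_measurable M" if "j \<in> I" for j
    using measurable_count_space_eq[OF assms(1)[OF that] assms(2)]
    unfolding of_bool_def by measurable
  then show ?thesis unfolding hits_def by (rule borel_measurable_sum)
qed

lemma measurable_weight:
  fixes l :: "'a \<Rightarrow> nat \<Rightarrow> 'c::countable"
  assumes l: "\<And>j. j \<le> n \<Longrightarrow> (\<lambda>x. l x j) \<in> measurable M (count_space UNIV)" and i: "i \<le> n"
  shows "(\<lambda>x. weight n (l x) i) \<in> borel_measurable M"
proof -
  have [measurable]: "Measurable.pred M (\<lambda>x. l x i = l x n)"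
    by (intro measurable_count_space_eq l i order_refl)
  have [measurable]: "(\<lambda>x. hits {..<n} (l x) n) \<in> borel_measurable M"
    by (intro measurable_hits l) auto
  show ?thesis unfolding weight_def of_bool_def by measurable
qed

section \<open>Exchangeability of independent, identically distributed points\<close>

lemma PiM_swap_nn_integral:
  assumes "prob_space P" and F: "F \<in> borel_measurable (PiM {..n} (\<lambda>_. P))" and i: "i \<le> (n::nat)"
  shows "(\<integral>\<^sup>+D. F (\<lambda>j\<in>{..n}. D (Transposition.transpose i n j)) \<partial>PiM {..n} (\<lambda>_. P)) = (\<integral>\<^sup>+D. F D \<partial>PiM {..n} (\<lambda>_. P))"
proof -
  let ?S = "PiM {..n} (\<lambda>_. P)" and ?s = "\<lambda>D. \<lambda>j\<in>{..n}. D (Transposition.transpose i n j)"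
  have t: "Transposition.transpose i n \<in> {..n} \<rightarrow> {..n}"
    using i by (auto simp: Transposition.transpose_def Pi_iff)
  then have m: "?s \<in> measurable ?S ?S"
    by (intro measurable_restrict measurable_component_singleton) auto
  have d: "distr ?S ?S ?s = ?S"
    by (rule distr_PiM_reindex[where K="{..n}" and I="{..n}" and M="\<lambda>_. P" and f="Transposition.transpose i n"])
       (use assms(1) t in \<open>simp_all only: inj_on_transpose\<close>)
  have "(\<integral>\<^sup>+D. F D \<partial>distr ?S ?S ?s) = (\<integral>\<^sup>+D. F (?s D) \<partial>?S)"
    by (rule nn_integral_distr[OF m]) (use F in simp)
  then show ?thesis unfolding d by simp
qed

lemma PiM_coordinate_nn_integral:
  assumes "prob_space P" and [measurable]: "h \<in> borel_measurable P" and i: "i \<le> (n::nat)"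
  shows "(\<integral>\<^sup>+D. h (D i) \<partial>PiM {..n} (\<lambda>_. P)) = (\<integral>\<^sup>+z. h z \<partial>P)"
proof -
  have "(\<integral>\<^sup>+z. h z \<partial>P) = (\<integral>\<^sup>+z. h z \<partial>distr (PiM {..n} (\<lambda>_. P)) P (\<lambda>D. D i))"
    by (subst distr_PiM_component) (use assms in auto)
  also have "\<dots> = (\<integral>\<^sup>+D. h (D i) \<partial>PiM {..n} (\<lambda>_. P))"
    using i by (intro nn_integral_distr) auto
  finally show ?thesis by simp
qed

text \<open>The tree is frozen: \<open>q\<close> sends a point to its label and \<open>C\<close>
  contains all labels. The query in position \<open>n\<close> has the same law \<open>P\<close> as
  the observations, response included, so that all n + 1 coordinates may trade places.\<close>

locale labelled_sample = prob_space P for P :: "'a measure" +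
  fixes q :: "'a \<Rightarrow> 'c::countable" and C :: "'c set" and n :: nat
  assumes q [measurable]: "q \<in> measurable P (count_space UNIV)"
    and C: "finite C" "\<And>z. z \<in> space P \<Longrightarrow> q z \<in> C"
begin

abbreviation "S \<equiv> PiM {..n} (\<lambda>_. P)"

definition lab :: "(nat \<Rightarrow> 'a) \<Rightarrow> nat \<Rightarrow> 'c" where "lab D i = q (D i)"

sublocale S: prob_space S by (intro prob_space_PiM prob_space_axioms)

lemma lab_measurable [measurable]: "i \<le> n \<Longrightarrow> (\<lambda>D. lab D i) \<in> measurable S (count_space UNIV)"
  unfolding lab_def by measurable

lemma hits_measurable [measurable]: "I \<subseteq> {..n} \<Longrightarrow> i \<le> n \<Longrightarrow> (\<lambda>D. hits I (lab D) i) \<in> borel_measurable S"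
  by (intro measurable_hits lab_measurable) auto

lemma weight_measurable [measurable]: "i \<le> n \<Longrightarrow> (\<lambda>D. weight n (lab D) i) \<in> borel_measurable S"
  by (intro measurable_weight lab_measurable) auto

text \<open>The count over all of \<open>{..n}\<close> does not depend on the order of the points;
  only the reference label moves from position \<open>n\<close> to position \<open>i\<close>. A
  count over \<open>{..<n}\<close> would lack this symmetry.\<close>

lemma hits_swap:
  assumes "i \<le> n"
  shows "hits {..n} (lab (\<lambda>j\<in>{..n}. D (Transposition.transpose i n j))) n = hits {..n} (lab D) i"
proof -
  have "bij_betw (Transposition.transpose i n) {..n} {..n}"
    by (rule bij_betw_byWitness[where f'="Transposition.transpose i n"]) (use assms in \<open>auto simp: Transposition.transpose_def\<close>)
  then have "hits {..n} (lab D) i = (\<Sum>j\<le>n. of_bool (lab D (Transposition.transpose i n j) = lab D i))"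
    unfolding hits_def by (rule sum.reindex_bij_betw[symmetric])
  then show ?thesis by (simp add: hits_def lab_def)
qed

lemma lab_eq_measurable [measurable]:
  "i \<le> n \<Longrightarrow> j \<le> n \<Longrightarrow> Measurable.pred S (\<lambda>D. lab D i = lab D j)"
  by (intro measurable_count_space_eq lab_measurable)

text \<open>Mass transport: swapping \<open>i\<close> and \<open>n\<close> turns the share of the
  i-th point in the class mean of the query into the share of the query in the class mean of the
  i-th point. Summed over \<open>i\<close>, the latter shares put total mass 1 on the value of
  \<open>h\<close> at the query.\<close>

lemma nn_integral_class_mean_le:
  assumes [measurable]: "h \<in> borel_measurable P"
  shows "(\<Sum>i\<le>n. \<integral>\<^sup>+D. ennreal (of_bool (lab D i = lab D n) / hits {..n} (lab D) n) * h (D i) \<partial>S)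
         \<le> (\<integral>\<^sup>+z. h z \<partial>P)"
proof -
  have meas [measurable]: "(\<lambda>D. ennreal (of_bool (lab D i = lab D n) / hits {..n} (lab D) n) * h (D i)) \<in> borel_measurable S"
    "(\<lambda>D. ennreal (of_bool (lab D i = lab D n) / hits {..n} (lab D) n) * h (D n)) \<in> borel_measurable S"
    if i: "i \<le> n" for i
  proof -
    have [simp]: "i \<in> {..n}" "i \<le> n" using i by auto
    show "(\<lambda>D. ennreal (of_bool (lab D i = lab D n) / hits {..n} (lab D) n) * h (D i)) \<in> borel_measurable S"
      unfolding of_bool_def by measurable
    show "(\<lambda>D. ennreal (of_bool (lab D i = lab D n) / hits {..n} (lab D) n) * h (D n)) \<in> borel_measurable S"
      unfolding of_bool_def by measurable
  qed
  have "(\<Sum>i\<le>n. \<integral>\<^sup>+D. ennreal (of_bool (lab D i = lab D n) / hits {..n} (lab D) n) * h (D i) \<partial>S)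
     = (\<Sum>i\<le>n. \<integral>\<^sup>+D. ennreal (of_bool (lab D i = lab D n) / hits {..n} (lab D) n) * h (D n) \<partial>S)"
  proof (rule sum.cong[OF refl])
    fix i assume "i \<in> {..n}" then have i: "i \<le> n" by simp
    let ?s = "\<lambda>D. \<lambda>j\<in>{..n}. D (Transposition.transpose i n j)"
    have "(\<integral>\<^sup>+D. ennreal (of_bool (lab D i = lab D n) / hits {..n} (lab D) n) * h (D i) \<partial>S)
      = (\<integral>\<^sup>+D. ennreal (of_bool (lab (?s D) i = lab (?s D) n) / hits {..n} (lab (?s D)) n) * h (?s D i) \<partial>S)"
      by (rule PiM_swap_nn_integral[symmetric, OF prob_space_axioms meas(1)[OF i] i])
    \<comment> \<open>After the swap the count is taken at \<open>i\<close>, but the indicator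
      retains only samples in which \<open>i\<close> and \<open>n\<close> share a label, and there
      the two counts agree.\<close>
    also have "\<dots> = (\<integral>\<^sup>+D. ennreal (of_bool (lab D i = lab D n) / hits {..n} (lab D) n) * h (D n) \<partial>S)"
      unfolding hits_swap[OF i]
      by (intro nn_integral_cong) (use i in \<open>auto simp: lab_def hits_def of_bool_def\<close>)
    finally show "(\<integral>\<^sup>+D. ennreal (of_bool (lab D i = lab D n) / hits {..n} (lab D) n) * h (D i) \<partial>S)
      = (\<integral>\<^sup>+D. ennreal (of_bool (lab D i = lab D n) / hits {..n} (lab D) n) * h (D n) \<partial>S)" .
  qed
  also have "\<dots> = (\<integral>\<^sup>+D. (\<Sum>i\<le>n. ennreal (of_bool (lab D i = lab D n) / hits {..n} (lab D) n) * h (D n)) \<partial>S)"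
    by (rule nn_integral_sum[symmetric]) (use meas in auto)
  also have "\<dots> = (\<integral>\<^sup>+D. h (D n) \<partial>S)"
  proof (rule nn_integral_cong)
    fix D
    have "(\<Sum>i\<le>n. ennreal (of_bool (lab D i = lab D n) / hits {..n} (lab D) n))
        = ennreal (\<Sum>i\<le>n. of_bool (lab D i = lab D n) / hits {..n} (lab D) n)"
      by (rule sum_ennreal) auto
    also have "(\<Sum>i\<le>n. of_bool (lab D i = lab D n) / hits {..n} (lab D) n) = (1::real)"
      using hits_ge_1[of "{..n}" n "lab D" n]
      by (simp add: sum_divide_distrib[symmetric] hits_def[symmetric] del: sum.atMost_Suc)
    finally show "(\<Sum>i\<le>n. ennreal (of_bool (lab D i = lab D n) / hits {..n} (lab D) n) * h (D n)) = h (D n)"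
      by (simp add: sum_distrib_right[symmetric])
  qed
  also have "\<dots> = (\<integral>\<^sup>+z. h z \<partial>P)"
    by (rule PiM_coordinate_nn_integral) (use prob_space_axioms in auto)
  finally show ?thesis by simp
qed

text \<open>By exchangeability all n + 1 positions have the same expected inverse class size, and
  these inverses add up to the number of occupied classes.\<close>

lemma nn_integral_inverse_hits_le:
  "(\<integral>\<^sup>+D. ennreal (1 / hits {..n} (lab D) n) \<partial>S) \<le> ennreal (real (card C) / real (n + 1))"
proof -
  let ?J = "\<integral>\<^sup>+D. ennreal (1 / hits {..n} (lab D) n) \<partial>S"
  have eq: "(\<integral>\<^sup>+D. ennreal (1 / hits {..n} (lab D) i) \<partial>S) = ?J" if "i \<le> n" for i
  proof -
    have "(\<integral>\<^sup>+D. ennreal (1 / hits {..n} (lab (\<lambda>j\<in>{..n}. D (Transposition.transpose i n j))) n) \<partial>S) = ?J"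
      by (rule PiM_swap_nn_integral[OF prob_space_axioms _ that]) measurable
    then show ?thesis by (simp add: hits_swap[OF that])
  qed
  have "ennreal (real (n + 1)) * ?J = (\<Sum>i\<le>n. \<integral>\<^sup>+D. ennreal (1 / hits {..n} (lab D) i) \<partial>S)"
  proof -
    have "(\<Sum>i\<le>n. \<integral>\<^sup>+D. ennreal (1 / hits {..n} (lab D) i) \<partial>S) = (\<Sum>i\<le>n. ?J)"
      by (intro sum.cong refl eq) simp
    also have "\<dots> = of_nat (n + 1) * ?J" by simp
    finally show ?thesis by (simp only: ennreal_of_nat_eq_real_of_nat)
  qed
  also have "\<dots> = (\<integral>\<^sup>+D. (\<Sum>i\<le>n. ennreal (1 / hits {..n} (lab D) i)) \<partial>S)"
    by (rule nn_integral_sum[symmetric]) auto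
  also have "\<dots> \<le> (\<integral>\<^sup>+D. ennreal (real (card C)) \<partial>S)"
  proof (rule nn_integral_mono)
    fix D assume "D \<in> space S"
    then have "lab D ` {..n} \<subseteq> C" using C(2) by (auto simp: lab_def space_PiM PiE_iff)
    then have "card (lab D ` {..n}) \<le> card C" using C(1) by (rule card_mono[rotated])
    moreover have "(\<Sum>i\<le>n. ennreal (1 / hits {..n} (lab D) i)) = ennreal (real (card (lab D ` {..n})))"
      by (subst sum_ennreal) (auto simp: sum_inverse_hits)
    ultimately show "(\<Sum>i\<le>n. ennreal (1 / hits {..n} (lab D) i)) \<le> ennreal (real (card C))"
      by (simp add: ennreal_leI)
  qed
  also have "\<dots> = ennreal (real (card C))"
    by (simp add: S.emeasure_space_1)
  finally have *: "ennreal (real (n + 1)) * ?J \<le> ennreal (real (card C))" .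
  have "?J = ennreal (1 / real (n + 1)) * (ennreal (real (n + 1)) * ?J)"
  proof -
    have "ennreal (1 / real (n + 1)) * ennreal (real (n + 1)) = ennreal (1 / real (n + 1) * real (n + 1))"
      by (rule ennreal_mult[symmetric]) auto
    also have "\<dots> = 1" by (simp del: of_nat_Suc of_nat_add)
    finally show ?thesis by (simp only: mult.assoc[symmetric] mult_1)
  qed
  also have "\<dots> \<le> ennreal (1 / real (n + 1)) * ennreal (real (card C))"
    using * by (rule mult_left_mono) simp
  also have "\<dots> = ennreal (real (card C) / real (n + 1))"
    by (simp add: ennreal_mult[symmetric])
  finally show ?thesis .
qed

text \<open>The factor 2 is that of \<open>weight_le\<close>. The term of the query itself is added
  to make the sum symmetric, at no loss because \<open>h\<close> is nonnegative.\<close>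

lemma nn_integral_weighted_mean_le:
  assumes [measurable]: "h \<in> borel_measurable P" and h: "\<And>z. 0 \<le> h z"
  shows "(\<integral>\<^sup>+D. ennreal (\<Sum>i<n. weight n (lab D) i * h (D i)) \<partial>S) \<le> 2 * (\<integral>\<^sup>+z. ennreal (h z) \<partial>P)"
proof -
  let ?f = "\<lambda>i D. ennreal (of_bool (lab D i = lab D n) / hits {..n} (lab D) n) * ennreal (h (D i))"
  have [measurable]: "?f i \<in> borel_measurable S" if i: "i \<le> n" for i
  proof -
    have [simp]: "i \<in> {..n}" "i \<le> n" using i by auto
    show ?thesis unfolding of_bool_def by measurable
  qed
  have "(\<integral>\<^sup>+D. ennreal (\<Sum>i<n. weight n (lab D) i * h (D i)) \<partial>S) \<le> (\<integral>\<^sup>+D. 2 * (\<Sum>i\<le>n. ?f i D) \<partial>S)"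
  proof (rule nn_integral_mono)
    fix D
    have "(\<Sum>i<n. weight n (lab D) i * h (D i)) \<le> (\<Sum>i<n. 2 * (of_bool (lab D i = lab D n) / hits {..n} (lab D) n) * h (D i))"
      by (intro sum_mono mult_right_mono weight_le h)
    also have "\<dots> \<le> (\<Sum>i\<le>n. 2 * (of_bool (lab D i = lab D n) / hits {..n} (lab D) n) * h (D i))"
      by (intro sum_mono2) (auto simp: h)
    finally have "ennreal (\<Sum>i<n. weight n (lab D) i * h (D i))
        \<le> ennreal (\<Sum>i\<le>n. 2 * (of_bool (lab D i = lab D n) / hits {..n} (lab D) n) * h (D i))"
      by (rule ennreal_leI)
    also have "\<dots> = (\<Sum>i\<le>n. 2 * ?f i D)"
    proof -
      have "ennreal (2 * a * b) = 2 * (ennreal a * ennreal b)" if "0 \<le> a" "0 \<le> b" for a b :: real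
        using that by (simp add: ennreal_mult mult.assoc)
      then show ?thesis by (subst sum_ennreal[symmetric]) (auto simp: h simp del: times_divide_eq_left times_divide_eq_right)
    qed
    finally show "ennreal (\<Sum>i<n. weight n (lab D) i * h (D i)) \<le> 2 * (\<Sum>i\<le>n. ?f i D)"
      by (simp add: sum_distrib_left)
  qed
  also have "\<dots> = 2 * (\<Sum>i\<le>n. \<integral>\<^sup>+D. ?f i D \<partial>S)"
    by (subst nn_integral_cmult, force, subst nn_integral_sum) auto
  also have "\<dots> \<le> 2 * (\<integral>\<^sup>+z. ennreal (h z) \<partial>P)"
    by (intro mult_left_mono nn_integral_class_mean_le) auto
  finally show ?thesis .
qed

lemma nn_integral_missing_weight_le:
  "(\<integral>\<^sup>+D. ennreal (1 - (\<Sum>i<n. weight n (lab D) i)) \<partial>S) \<le> ennreal (real (card C) / real (n + 1))"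
  by (rule order_trans[OF nn_integral_mono nn_integral_inverse_hits_le])
     (intro ennreal_leI one_minus_sum_weight_le)

section \<open>Second moment of the averaged noise\<close>

lemma coordinate_integrable:
  fixes f :: "'a \<Rightarrow> real"
  assumes f: "integrable P f" and i: "i \<le> n"
  shows "integrable S (\<lambda>D. f (D i))"
proof -
  have "distr S P (\<lambda>D. D i) = P"
    by (rule distr_PiM_component) (use i prob_space_axioms in auto)
  then have "integrable (distr S P (\<lambda>D. D i)) f" using f by simp
  moreover have "(\<lambda>D. D i) \<in> measurable S P" using i by auto
  ultimately show ?thesis by (rule integrable_distr[rotated])
qed

text \<open>The weights lie between 0 and 1, and 2 |a b| \<le> a^2 + b^2 supplies a dominating
  function from the second moment alone.\<close>

lemma noise_products_integrable:
  fixes r :: "'a \<Rightarrow> real"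
  assumes r [measurable]: "r \<in> borel_measurable P" and r2: "integrable P (\<lambda>z. (r z)\<^sup>2)"
    and ij: "i \<le> n" "j \<le> n"
  shows "integrable S (\<lambda>D. weight n (lab D) i * weight n (lab D) j * r (D i) * r (D j))"
proof (rule Bochner_Integration.integrable_bound)
  show "integrable S (\<lambda>D. (r (D i))\<^sup>2 + (r (D j))\<^sup>2)"
    using coordinate_integrable[OF r2] ij by (intro Bochner_Integration.integrable_add) auto
  have [simp]: "i \<in> {..n}" "j \<in> {..n}" "i \<le> n" "j \<le> n" using ij by auto
  show "(\<lambda>D. weight n (lab D) i * weight n (lab D) j * r (D i) * r (D j)) \<in> borel_measurable S"
    by measurable
  show "AE D in S. norm (weight n (lab D) i * weight n (lab D) j * r (D i) * r (D j))
      \<le> norm ((r (D i))\<^sup>2 + (r (D j))\<^sup>2)"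
  proof (rule AE_I2)
    fix D
    have "\<bar>weight n (lab D) i * weight n (lab D) j\<bar> * \<bar>r (D i) * r (D j)\<bar> \<le> 1 * \<bar>r (D i) * r (D j)\<bar>"
      by (intro mult_right_mono) (auto simp: abs_mult intro!: mult_le_one weight_le_1)
    also have "\<dots> \<le> (r (D i))\<^sup>2 + (r (D j))\<^sup>2"
    proof -
      have "2 * (\<bar>r (D i)\<bar> * \<bar>r (D j)\<bar>) \<le> (r (D i))\<^sup>2 + (r (D j))\<^sup>2"
        using sum_squares_bound[of "\<bar>r (D i)\<bar>" "\<bar>r (D j)\<bar>"] by (simp add: mult_ac)
      moreover have "0 \<le> \<bar>r (D i)\<bar> * \<bar>r (D j)\<bar>" by (intro mult_nonneg_nonneg abs_ge_zero)
      ultimately show ?thesis unfolding mult_1 abs_mult by linarith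
    qed
    finally show "norm (weight n (lab D) i * weight n (lab D) j * r (D i) * r (D j))
      \<le> norm ((r (D i))\<^sup>2 + (r (D j))\<^sup>2)"
      by (simp add: abs_mult mult.assoc)
  qed
qed

text \<open>Freeze all points except the i-th. The weights see that point through its label only,
  and \<open>r (D j)\<close> is frozen as j differs from i. So the inner integrand is a function of
  the label times \<open>r\<close>, and \<open>r\<close> is orthogonal to all functions of the
  label.\<close>

lemma noise_uncorrelated:
  fixes r :: "'a \<Rightarrow> real"
  assumes r [measurable]: "r \<in> borel_measurable P" and r2: "integrable P (\<lambda>z. (r z)\<^sup>2)"
    and orth: "\<And>c. (\<integral>z. of_bool (q z = c) * r z \<partial>P) = 0"
    and ij: "i \<le> n" "j \<le> n" "i \<noteq> j"
  shows "(\<integral>D. weight n (lab D) i * weight n (lab D) j * r (D i) * r (D j) \<partial>S) = 0"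
proof -
  interpret product_sigma_finite "\<lambda>_::nat. P"
    by unfold_locales
  have r1: "integrable P r" by (rule square_integrable_imp_integrable[OF r r2])
  have [measurable]: "Measurable.pred P (\<lambda>z. q z = c)" for c by measurable
  have rc: "integrable P (\<lambda>z. of_bool (q z = c) * r z)" for c
    by (rule Bochner_Integration.integrable_bound[OF r1]) (auto simp: of_bool_def)
  have ins: "insert i ({..n} - {i}) = {..n}" using ij by auto
  let ?F = "\<lambda>D. weight n (lab D) i * weight n (lab D) j * r (D i) * r (D j)"
  have split: "(\<integral>D. ?F D \<partial>S) = (\<integral>D. (\<integral>y. ?F (D(i := y)) \<partial>P) \<partial>PiM ({..n} - {i}) (\<lambda>_. P))"
    using product_integral_insert[of "{..n} - {i}" i ?F] noise_products_integrable[OF r r2 ij(1,2)]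
    unfolding ins by blast
  have "(\<integral>y. ?F (D(i := y)) \<partial>P) = 0" for D
  proof -
    define \<psi> where "\<psi> c = weight n ((lab D)(i := c)) i * weight n ((lab D)(i := c)) j * r (D j)" for c
    have "(\<integral>y. ?F (D(i := y)) \<partial>P) = (\<integral>y. (\<Sum>c\<in>C. \<psi> c * (of_bool (q y = c) * r y)) \<partial>P)"
    proof (rule Bochner_Integration.integral_cong[OF refl])
      fix y assume "y \<in> space P"
      have "(\<Sum>c\<in>C. \<psi> c * (of_bool (q y = c) * r y)) = \<psi> (q y) * r y"
      proof -
        have "(\<Sum>c\<in>C. \<psi> c * (of_bool (q y = c) * r y)) = (\<Sum>c\<in>C. if c = q y then \<psi> c * r y else 0)"
          by (intro sum.cong) auto
        also have "\<dots> = \<psi> (q y) * r y" using C \<open>y \<in> space P\<close> by simp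
        finally show ?thesis .
      qed
      moreover have "lab (D(i := y)) = (lab D)(i := q y)" by (auto simp: lab_def)
      ultimately show "?F (D(i := y)) = (\<Sum>c\<in>C. \<psi> c * (of_bool (q y = c) * r y))"
        using ij by (simp add: \<psi>_def)
    qed
    also have "\<dots> = (\<Sum>c\<in>C. \<psi> c * (\<integral>y. of_bool (q y = c) * r y \<partial>P))"
      using rc by (subst Bochner_Integration.integral_sum) auto
    finally show ?thesis by (simp only: orth mult_zero_right sum.neutral_const)
  qed
  then show ?thesis unfolding split by (simp only: Bochner_Integration.integral_zero)
qed

text \<open>
  The squared noise is only integrable: its part below the level \<open>L\<close> is damped by the sum of the
  squared weights, its part above \<open>L\<close> is small on average.
\<close>

lemma nn_integral_noise_le:
  fixes r :: "'a \<Rightarrow> real"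
  assumes r [measurable]: "r \<in> borel_measurable P" and r2: "integrable P (\<lambda>z. (r z)\<^sup>2)"
    and orth: "\<And>c. (\<integral>z. of_bool (q z = c) * r z \<partial>P) = 0" and L: "0 \<le> L"
  shows "(\<integral>\<^sup>+D. ennreal ((\<Sum>i<n. weight n (lab D) i * r (D i))\<^sup>2) \<partial>S)
    \<le> ennreal (2 * L) * ennreal (real (card C) / real (n + 1)) + 2 * (\<integral>\<^sup>+z. ennreal (max 0 ((r z)\<^sup>2 - L)) \<partial>P)"
proof -
  let ?w = "\<lambda>D i. weight n (lab D) i"
  let ?h = "\<lambda>z. max 0 ((r z)\<^sup>2 - L)"
  let ?F = "\<lambda>i j D. ?w D i * ?w D j * r (D i) * r (D j)"
  note int = noise_products_integrable[OF r r2]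
  have sq: "(\<Sum>i<n. ?w D i * r (D i))\<^sup>2 = (\<Sum>i<n. \<Sum>j<n. ?F i j D)" for D
    by (simp add: power2_eq_square sum_product mult_ac)
  have int_sq: "integrable S (\<lambda>D. (\<Sum>i<n. ?w D i * r (D i))\<^sup>2)"
    unfolding sq by (intro Bochner_Integration.integrable_sum int) auto
  have int_diag: "integrable S (\<lambda>D. \<Sum>i<n. ?F i i D)"
    by (intro Bochner_Integration.integrable_sum int) auto
  have "(\<integral>D. (\<Sum>i<n. ?w D i * r (D i))\<^sup>2 \<partial>S) = (\<Sum>i<n. \<Sum>j<n. \<integral>D. ?F i j D \<partial>S)"
    unfolding sq
    by (subst Bochner_Integration.integral_sum, (intro Bochner_Integration.integrable_sum int; simp),
        intro sum.cong refl, subst Bochner_Integration.integral_sum) (auto intro!: int)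
  also have "\<dots> = (\<Sum>i<n. \<integral>D. ?F i i D \<partial>S)"
  proof (rule sum.cong[OF refl])
    fix i assume i: "i \<in> {..<n}"
    have "(\<Sum>j<n. \<integral>D. ?F i j D \<partial>S) = (\<Sum>j<n. if j = i then \<integral>D. ?F i i D \<partial>S else 0)"
      by (intro sum.cong refl) (use i in \<open>auto intro!: noise_uncorrelated[OF r r2 orth]\<close>)
    then show "(\<Sum>j<n. \<integral>D. ?F i j D \<partial>S) = (\<integral>D. ?F i i D \<partial>S)"
      using i by simp
  qed
  also have "\<dots> = (\<integral>D. (\<Sum>i<n. ?F i i D) \<partial>S)"
    by (rule Bochner_Integration.integral_sum[symmetric]) (auto intro!: int)
  finally have eq: "(\<integral>D. (\<Sum>i<n. ?w D i * r (D i))\<^sup>2 \<partial>S) = (\<integral>D. (\<Sum>i<n. ?F i i D) \<partial>S)" .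
  have diag_nonneg: "0 \<le> ?F i i D" for i D
    using mult_nonneg_nonneg[OF zero_le_square[of "?w D i"] zero_le_square[of "r (D i)"]] by (simp add: mult_ac)
  have [measurable]: "(\<lambda>D. \<Sum>i<n. ?w D i * ?h (D i)) \<in> borel_measurable S"
  proof (rule borel_measurable_sum)
    fix i assume "i \<in> {..<n}"
    then have [simp]: "i \<in> {..n}" "i \<le> n" by auto
    show "(\<lambda>D. ?w D i * ?h (D i)) \<in> borel_measurable S" by measurable
  qed
  \<comment> \<open>The integrands differ by the off-diagonal terms; only their integrals agree.
    From here on everything is nonnegative and the bound can be pointwise.\<close>
  have "(\<integral>\<^sup>+D. ennreal ((\<Sum>i<n. ?w D i * r (D i))\<^sup>2) \<partial>S) = (\<integral>\<^sup>+D. ennreal (\<Sum>i<n. ?F i i D) \<partial>S)"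
    by (subst (1 2) nn_integral_eq_integral)
       (auto simp: eq int_diag intro!: int_sq sum_nonneg diag_nonneg)
  also have "\<dots> \<le> (\<integral>\<^sup>+D. ennreal (2 * L) * ennreal (1 / hits {..n} (lab D) n) + ennreal (\<Sum>i<n. ?w D i * ?h (D i)) \<partial>S)"
  proof (rule nn_integral_mono)
    fix D
    have "?F i i D \<le> L * (?w D i)\<^sup>2 + ?w D i * ?h (D i)" for i
    proof -
      \<comment> \<open>The bounded part of the squared noise keeps the squared weight, whose sum is
        small. The excess gives up one factor of weight to become a weighted mean of
        \<open>?h\<close>.\<close>
      have "?F i i D = (?w D i)\<^sup>2 * (r (D i))\<^sup>2" by (simp add: power2_eq_square)
      also have "\<dots> \<le> (?w D i)\<^sup>2 * (L + ?h (D i))" by (intro mult_left_mono) auto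
      also have "\<dots> \<le> L * (?w D i)\<^sup>2 + ?w D i * ?h (D i)"
      proof -
        have "(?w D i)\<^sup>2 \<le> ?w D i" using weight_le_1[of n "lab D" i] weight_nonneg[of n "lab D" i]
          by (simp add: power2_eq_square mult_left_le)
        then have "(?w D i)\<^sup>2 * ?h (D i) \<le> ?w D i * ?h (D i)" by (intro mult_right_mono) auto
        then show ?thesis by (simp add: algebra_simps)
      qed
      finally show ?thesis .
    qed
    then have "(\<Sum>i<n. ?F i i D) \<le> (\<Sum>i<n. L * (?w D i)\<^sup>2 + ?w D i * ?h (D i))"
      by (intro sum_mono)
    also have "\<dots> = L * (\<Sum>i<n. (?w D i)\<^sup>2) + (\<Sum>i<n. ?w D i * ?h (D i))"
      by (simp add: sum.distrib sum_distrib_left)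
    also have "\<dots> \<le> L * (2 / hits {..n} (lab D) n) + (\<Sum>i<n. ?w D i * ?h (D i))"
      by (intro add_right_mono mult_left_mono sum_weight_square_le L)
    finally have "ennreal (\<Sum>i<n. ?F i i D)
        \<le> ennreal (2 * L * (1 / hits {..n} (lab D) n) + (\<Sum>i<n. ?w D i * ?h (D i)))"
      by (intro ennreal_leI) (simp add: mult_ac)
    also have "\<dots> = ennreal (2 * L) * ennreal (1 / hits {..n} (lab D) n) + ennreal (\<Sum>i<n. ?w D i * ?h (D i))"
      using L by (subst ennreal_plus) (auto intro!: sum_nonneg simp: ennreal_mult[symmetric])
    finally show "ennreal (\<Sum>i<n. ?F i i D)
        \<le> ennreal (2 * L) * ennreal (1 / hits {..n} (lab D) n) + ennreal (\<Sum>i<n. ?w D i * ?h (D i))" .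
  qed
  also have "\<dots> = ennreal (2 * L) * (\<integral>\<^sup>+D. ennreal (1 / hits {..n} (lab D) n) \<partial>S) + (\<integral>\<^sup>+D. ennreal (\<Sum>i<n. ?w D i * ?h (D i)) \<partial>S)"
    by (subst nn_integral_add) (auto simp: nn_integral_cmult)
  also have "\<dots> \<le> ennreal (2 * L) * ennreal (real (card C) / real (n + 1)) + 2 * (\<integral>\<^sup>+z. ennreal (?h z) \<partial>P)"
    by (intro add_mono mult_left_mono nn_integral_inverse_hits_le nn_integral_weighted_mean_le) auto
  finally show ?thesis .
qed

end
section \<open>Continuous approximation in mean square\<close>

text \<open>The integral of a nonintegrable difference would be 0, so the closure lemmas below carry
  integrability next to this predicate.\<close>

definition l1_approximable :: "'a::topological_space measure \<Rightarrow> ('a \<Rightarrow> real) \<Rightarrow> bool" where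
  "l1_approximable \<mu> f \<longleftrightarrow>
     (\<forall>e>0. \<exists>g. continuous_on UNIV g \<and> bounded (range g) \<and> (\<integral>x. \<bar>f x - g x\<bar> \<partial>\<mu>) < e)"

lemma bounded_continuous_integrable:
  fixes g :: "'a::topological_space \<Rightarrow> real"
  assumes "finite_measure M" "sets M = sets borel" "continuous_on UNIV g" "bounded (range g)"
  shows "integrable M g"
proof -
  interpret finite_measure M by fact
  obtain b where "\<And>x. norm (g x) \<le> b" using assms(4) by (auto simp: bounded_iff)
  moreover have "g \<in> borel_measurable M"
    using borel_measurable_continuous_onI[OF assms(3)] assms(2) by (simp cong: measurable_cong_sets)
  ultimately show ?thesis by (intro integrable_const_bound[of g b]) auto
qed

lemma l1_approximable_closure:
  fixes \<mu> :: "'a::topological_space measure"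
  assumes "finite_measure \<mu>" "sets \<mu> = sets borel" and f: "integrable \<mu> f"
    and h: "\<And>e. e > 0 \<Longrightarrow> \<exists>h. integrable \<mu> h \<and> l1_approximable \<mu> h \<and> (\<integral>x. \<bar>f x - h x\<bar> \<partial>\<mu>) < e"
  shows "l1_approximable \<mu> f"
  unfolding l1_approximable_def
proof (intro allI impI)
  interpret finite_measure \<mu> by fact
  fix e :: real assume e: "e > 0"
  obtain h where h: "integrable \<mu> h" "l1_approximable \<mu> h" "(\<integral>x. \<bar>f x - h x\<bar> \<partial>\<mu>) < e / 2"
    using h[of "e / 2"] e by auto
  obtain g where g: "continuous_on UNIV g" "bounded (range g)" "(\<integral>x. \<bar>h x - g x\<bar> \<partial>\<mu>) < e / 2"
    using h(2) e unfolding l1_approximable_def by (meson half_gt_zero)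
  have [simp]: "integrable \<mu> g" by (intro bounded_continuous_integrable assms g)
  have "(\<integral>x. \<bar>f x - g x\<bar> \<partial>\<mu>) \<le> (\<integral>x. \<bar>f x - h x\<bar> + \<bar>h x - g x\<bar> \<partial>\<mu>)"
    using f h by (intro integral_mono) auto
  also have "\<dots> = (\<integral>x. \<bar>f x - h x\<bar> \<partial>\<mu>) + (\<integral>x. \<bar>h x - g x\<bar> \<partial>\<mu>)"
    using f h by (intro Bochner_Integration.integral_add) auto
  finally show "\<exists>g. continuous_on UNIV g \<and> bounded (range g) \<and> (\<integral>x. \<bar>f x - g x\<bar> \<partial>\<mu>) < e"
    using g h by (intro exI[of _ g]) auto
qed

text \<open>Dominated convergence makes the pointwise limit a limit in mean. The form fits the limit
  case of \<open>integrable_induct\<close>, where 2 |f| dominates, and also the approach to an open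
  set from inside.\<close>

lemma l1_approximable_limit:
  fixes \<mu> :: "'a::topological_space measure"
  assumes "finite_measure \<mu>" "sets \<mu> = sets borel" and f: "integrable \<mu> f"
    and s: "\<And>i. integrable \<mu> (s i)" "\<And>i. l1_approximable \<mu> (s i)"
    and lim: "\<And>x. x \<in> space \<mu> \<Longrightarrow> (\<lambda>i. s i x) \<longlonglongrightarrow> f x"
    and w: "integrable \<mu> w" "\<And>i x. x \<in> space \<mu> \<Longrightarrow> \<bar>s i x\<bar> \<le> w x"
  shows "l1_approximable \<mu> f"
proof (rule l1_approximable_closure[OF assms(1-3)])
  fix e :: real assume e: "e > 0"
  have "(\<lambda>i. \<integral>x. \<bar>f x - s i x\<bar> \<partial>\<mu>) \<longlonglongrightarrow> (\<integral>x. 0 \<partial>\<mu>)"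
  proof (rule integral_dominated_convergence[where w="\<lambda>x. \<bar>f x\<bar> + w x"])
    show "AE x in \<mu>. (\<lambda>i. \<bar>f x - s i x\<bar>) \<longlonglongrightarrow> 0"
      using lim by (intro AE_I2 tendsto_rabs_zero) (auto intro!: tendsto_eq_intros)
    show "AE x in \<mu>. norm \<bar>f x - s i x\<bar> \<le> \<bar>f x\<bar> + w x" for i
    proof (rule AE_I2)
      fix x assume "x \<in> space \<mu>"
      from w(2)[OF this, of i] show "norm \<bar>f x - s i x\<bar> \<le> \<bar>f x\<bar> + w x" by simp
    qed
  qed (use f s w in auto)
  then have "\<forall>\<^sub>F i in sequentially. (\<integral>x. \<bar>f x - s i x\<bar> \<partial>\<mu>) < e"
    using e by (intro order_tendstoD(2)) auto
  then obtain i where "(\<integral>x. \<bar>f x - s i x\<bar> \<partial>\<mu>) < e"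
    by (auto simp: eventually_sequentially)
  then show "\<exists>h. integrable \<mu> h \<and> l1_approximable \<mu> h \<and> (\<integral>x. \<bar>f x - h x\<bar> \<partial>\<mu>) < e"
    using s by blast
qed

lemma l1_approximable_continuous:
  "continuous_on UNIV g \<Longrightarrow> bounded (range g) \<Longrightarrow> l1_approximable \<mu> g"
  unfolding l1_approximable_def by (intro allI impI exI[of _ g]) auto

text \<open>Multiples of the distance to the complement, cut off at 1, are continuous and converge
  pointwise to the indicator.\<close>

lemma l1_approximable_open:
  fixes \<mu> :: "'a::metric_space measure"
  assumes "finite_measure \<mu>" "sets \<mu> = sets borel" and U: "open U"
  shows "l1_approximable \<mu> (indicator U)"
\<comment> \<open>\<open>infdist\<close> to the empty set is 0 by convention, so the functions
  \<open>s\<close> below would vanish if \<open>U\<close> were the whole space.\<close>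
proof (cases "U = UNIV")
  case True
  then show ?thesis by (intro l1_approximable_continuous) (auto simp: bounded_iff)
next
  case False
  interpret finite_measure \<mu> by fact
  define s where "s i x = min 1 (real i * infdist x (- U))" for i x
  have s01: "0 \<le> s i x" "s i x \<le> 1" for i x
    by (auto simp: s_def infdist_nonneg)
  have s: "continuous_on UNIV (s i)" "bounded (range (s i))" for i
    using s01 by (auto simp: s_def bounded_iff intro!: continuous_intros exI[of _ 1])
  have "U \<in> sets \<mu>" using U assms(2) by simp
  then have int_U: "integrable \<mu> (indicator U :: 'a \<Rightarrow> real)" by (simp add: emeasure_eq_measure)
  show ?thesis
  proof (rule l1_approximable_limit[OF assms(1,2) int_U, where s=s and w="\<lambda>_. 1"])
    fix x assume "x \<in> space \<mu>"
    show "(\<lambda>i. s i x) \<longlonglongrightarrow> indicator U x"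
    proof (cases "x \<in> U")
      case True
      have "infdist x (- U) > 0"
        using in_closed_iff_infdist_zero[of "- U" x] True False U infdist_nonneg[of x "- U"] by force
      then obtain k where k: "1 < real k * infdist x (- U)"
        using ex_less_of_nat_mult by blast
      have "1 \<le> real i * infdist x (- U)" if "k \<le> i" for i
        using k mult_right_mono[of "real k" "real i" "infdist x (- U)"] that infdist_nonneg[of x "- U"] by simp
      then have "\<forall>\<^sub>F i in sequentially. 1 \<le> real i * infdist x (- U)"
        by (rule eventually_sequentiallyI)
      then have "\<forall>\<^sub>F i in sequentially. s i x = 1"
        by eventually_elim (simp add: s_def)
      then show ?thesis using True by (simp add: tendsto_eventually)
    qed (simp add: s_def)
  qed (use s s01 assms(1,2) in \<open>auto intro!: bounded_continuous_integrable l1_approximable_continuous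
        simp: emeasure_eq_measure\<close>)
qed

text \<open>Outer regularity of a finite Borel measure on a Polish space supplies an open superset
  of almost the same measure.\<close>

lemma l1_approximable_indicator:
  fixes \<mu> :: "'a::{second_countable_topology, complete_space} measure"
  assumes "finite_measure \<mu>" "sets \<mu> = sets borel" and A: "A \<in> sets borel"
  shows "l1_approximable \<mu> (indicator A)"
proof (rule l1_approximable_closure[OF assms(1,2)])
  interpret finite_measure \<mu> by fact
  show "integrable \<mu> (indicator A :: 'a \<Rightarrow> real)" using A assms(2) by (simp add: emeasure_eq_measure)
  fix e :: real assume e: "e > 0"
  have "emeasure \<mu> A = (INF U\<in>{U. A \<subseteq> U \<and> open U}. emeasure \<mu> U)"
    by (rule outer_regular[OF assms(2) _ A]) simp
  moreover have "emeasure \<mu> A < emeasure \<mu> A + ennreal e"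
    using e by (simp add: emeasure_eq_measure ennreal_plus[symmetric] ennreal_less_iff del: ennreal_plus)
  ultimately have "(INF U\<in>{U. A \<subseteq> U \<and> open U}. emeasure \<mu> U) < emeasure \<mu> A + ennreal e" by simp
  then obtain U where U: "A \<subseteq> U" "open U" "emeasure \<mu> U < emeasure \<mu> A + ennreal e"
    unfolding INF_less_iff by blast
  have [simp]: "U \<in> sets \<mu>" "A \<in> sets \<mu>" using U A assms(2) by auto
  have "\<bar>indicator A x - indicator U x\<bar> = (indicator (U - A) x :: real)" for x
    using U(1) by (auto simp: indicator_def)
  then have "(\<integral>x. \<bar>indicator A x - indicator U x\<bar> \<partial>\<mu>) = measure \<mu> (U - A)"
    using sets_eq_imp_space_eq[OF assms(2)] by simp
  also have "\<dots> = measure \<mu> U - measure \<mu> A" using U by (intro finite_measure_Diff) auto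
  also have "\<dots> < e"
    using U(3) e by (simp add: emeasure_eq_measure ennreal_plus[symmetric] ennreal_less_iff del: ennreal_plus)
  finally show "\<exists>h. integrable \<mu> h \<and> l1_approximable \<mu> h \<and> (\<integral>x. \<bar>indicator A x - h x\<bar> \<partial>\<mu>) < e"
    using U l1_approximable_open[OF assms(1,2) U(2)]
    by (intro exI[of _ "indicator U"]) (auto simp: emeasure_eq_measure)
qed

lemma integrable_imp_l1_approximable:
  fixes \<mu> :: "'a::{second_countable_topology, complete_space} measure"
  assumes "finite_measure \<mu>" "sets \<mu> = sets borel" and f: "integrable \<mu> f"
  shows "l1_approximable \<mu> f"
  using f
proof (induction rule: integrable_induct)
  case (base A c)
  interpret finite_measure \<mu> by fact
  show ?case unfolding l1_approximable_def
  proof (intro allI impI)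
    fix e :: real assume e: "e > 0"
    \<comment> \<open>Adding 1 to |c| covers c = 0 and makes the final inequality strict.\<close>
    obtain g where g: "continuous_on UNIV g" "bounded (range g)" "(\<integral>x. \<bar>indicator A x - g x\<bar> \<partial>\<mu>) < e / (\<bar>c\<bar> + 1)"
      using l1_approximable_indicator[OF assms(1,2), of A] base e assms(2)
      unfolding l1_approximable_def by (metis abs_ge_zero add_nonneg_pos divide_pos_pos zero_less_one)
    have "(\<integral>x. \<bar>indicator A x *\<^sub>R c - c * g x\<bar> \<partial>\<mu>) = (\<integral>x. \<bar>c\<bar> * \<bar>indicator A x - g x\<bar> \<partial>\<mu>)"
      by (intro Bochner_Integration.integral_cong) (auto simp: abs_mult[symmetric] algebra_simps)
    also have "\<dots> = \<bar>c\<bar> * (\<integral>x. \<bar>indicator A x - g x\<bar> \<partial>\<mu>)" by simp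
    also have "\<dots> \<le> \<bar>c\<bar> * (e / (\<bar>c\<bar> + 1))" using g by (intro mult_left_mono) auto
    also have "\<dots> < e" using e by (simp add: field_simps)
    finally show "\<exists>g. continuous_on UNIV g \<and> bounded (range g) \<and> (\<integral>x. \<bar>indicator A x *\<^sub>R c - g x\<bar> \<partial>\<mu>) < e"
      using g by (intro exI[of _ "\<lambda>x. c * g x"]) (auto intro!: continuous_intros bounded_scaleR_comp[where 'b=real, simplified])
  qed
next
  case (add f g)
  interpret finite_measure \<mu> by fact
  show ?case unfolding l1_approximable_def
  proof (intro allI impI)
    fix e :: real assume e: "e > 0"
    obtain f' where f': "continuous_on UNIV f'" "bounded (range f')" "(\<integral>x. \<bar>f x - f' x\<bar> \<partial>\<mu>) < e / 2"
      using add e unfolding l1_approximable_def by (meson half_gt_zero)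
    obtain g' where g': "continuous_on UNIV g'" "bounded (range g')" "(\<integral>x. \<bar>g x - g' x\<bar> \<partial>\<mu>) < e / 2"
      using add e unfolding l1_approximable_def by (meson half_gt_zero)
    have [simp]: "integrable \<mu> f'" "integrable \<mu> g'" 
      using f' g' assms(1,2) by (auto intro!: bounded_continuous_integrable)
    have "(\<integral>x. \<bar>f x + g x - (f' x + g' x)\<bar> \<partial>\<mu>) \<le> (\<integral>x. \<bar>f x - f' x\<bar> + \<bar>g x - g' x\<bar> \<partial>\<mu>)"
      using add by (intro integral_mono) auto
    also have "\<dots> = (\<integral>x. \<bar>f x - f' x\<bar> \<partial>\<mu>) + (\<integral>x. \<bar>g x - g' x\<bar> \<partial>\<mu>)"
      using add by (intro Bochner_Integration.integral_add) auto
    finally show "\<exists>h. continuous_on UNIV h \<and> bounded (range h) \<and> (\<integral>x. \<bar>f x + g x - h x\<bar> \<partial>\<mu>) < e"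
      using f' g' by (intro exI[of _ "\<lambda>x. f' x + g' x"]) (auto intro!: continuous_intros bounded_plus_comp)
  qed
next
  case (lim f s)
  show ?case
    by (rule l1_approximable_limit[OF assms(1,2), where s=s and w="\<lambda>x. 2 * \<bar>f x\<bar>"]) (use lim in auto)
qed

text \<open>Approximation in mean becomes approximation in mean square once both functions are
  bounded by the same level \<open>L\<close>: their squared distance is then at most 2 L times their
  distance. Hence \<open>m\<close> is clipped first, and the continuous approximation is clipped
  too; clipping is a contraction, so it does not increase the distance to the clipped
  \<open>m\<close>.\<close>

lemma l2_continuous_approximation:
  fixes \<mu> :: "'a::{second_countable_topology, complete_space} measure" and m :: "'a \<Rightarrow> real"
  assumes "finite_measure \<mu>" "sets \<mu> = sets borel"
    and m [measurable]: "m \<in> borel_measurable \<mu>" and m2: "integrable \<mu> (\<lambda>x. (m x)\<^sup>2)" and e: "e > 0"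
  obtains g L where "continuous_on UNIV g" "0 < L" "\<And>x. \<bar>g x\<bar> \<le> L"
    "(\<integral>\<^sup>+x. ennreal ((m x - g x)\<^sup>2) \<partial>\<mu>) < ennreal e"
proof -
  interpret finite_measure \<mu> by fact
  define clip :: "real \<Rightarrow> real \<Rightarrow> real" where "clip L y = max (- L) (min L y)" for L y
  have clip_bound: "\<bar>clip L y\<bar> \<le> L" if "0 \<le> L" for L y using that by (auto simp: clip_def)
  have clip_dist: "\<bar>clip L y - clip L z\<bar> \<le> \<bar>y - z\<bar>" for L y z by (auto simp: clip_def)
  have clip_id: "clip L y = y" if "\<bar>y\<bar> \<le> L" for L y using that by (auto simp: clip_def)
  have [measurable]: "clip L \<in> borel_measurable borel" for L unfolding clip_def by measurable
  have tail_le: "(m x - clip L (m x))\<^sup>2 \<le> (m x)\<^sup>2" if "0 \<le> L" for x L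
    using that by (intro abs_le_square_iff[THEN iffD1]) (auto simp: clip_def)
  have "(\<lambda>i. \<integral>x. (m x - clip (real i) (m x))\<^sup>2 \<partial>\<mu>) \<longlonglongrightarrow> (\<integral>x. 0 \<partial>\<mu>)"
  proof (rule integral_dominated_convergence[where w="\<lambda>x. (m x)\<^sup>2"])
    show "AE x in \<mu>. (\<lambda>i. (m x - clip (real i) (m x))\<^sup>2) \<longlonglongrightarrow> 0"
    proof (rule AE_I2)
      fix x
      obtain k :: nat where "\<bar>m x\<bar> \<le> real k" using real_arch_simple by blast
      then have "\<forall>\<^sub>F i in sequentially. (m x - clip (real i) (m x))\<^sup>2 = 0"
        by (auto simp: eventually_sequentially clip_id intro!: exI[of _ k])
      then show "(\<lambda>i. (m x - clip (real i) (m x))\<^sup>2) \<longlonglongrightarrow> 0" by (rule tendsto_eventually)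
    qed
  qed (use m2 tail_le in auto)
  then have "\<forall>\<^sub>F i in sequentially. (\<integral>x. (m x - clip (real i) (m x))\<^sup>2 \<partial>\<mu>) < e / 4"
    using e by (intro order_tendstoD(2)) auto
  then have "\<forall>\<^sub>F i in sequentially. 0 < i \<and> (\<integral>x. (m x - clip (real i) (m x))\<^sup>2 \<partial>\<mu>) < e / 4"
    using eventually_gt_at_top[of "0::nat"] by eventually_elim auto
  then obtain i :: nat where i: "0 < i" "(\<integral>x. (m x - clip (real i) (m x))\<^sup>2 \<partial>\<mu>) < e / 4"
    by (auto simp: eventually_sequentially)
  define L where "L = real i"
  have L: "0 < L" using i by (simp add: L_def)
  let ?mL = "\<lambda>x. clip L (m x)"
  have int_mL [simp]: "integrable \<mu> ?mL"
    by (rule integrable_const_bound[where B=L]) (use clip_bound L in auto)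
  \<comment> \<open>The distance is multiplied by 4 L in \<open>pt\<close>, so this choice
    contributes less than e/2. The tail, below e/4, enters with factor 2.\<close>
  obtain g0 where g0: "continuous_on UNIV g0" "bounded (range g0)" "(\<integral>x. \<bar>?mL x - g0 x\<bar> \<partial>\<mu>) < e / (8 * L)"
    using integrable_imp_l1_approximable[OF assms(1,2) int_mL] e L unfolding l1_approximable_def
    by (meson divide_pos_pos mult_pos_pos zero_less_numeral)
  define g where "g x = clip L (g0 x)" for x
  have g: "continuous_on UNIV g"
    unfolding g_def clip_def by (intro continuous_intros g0)
  have gL: "\<bar>g x\<bar> \<le> L" for x using clip_bound L by (simp add: g_def)
  have int_g [simp]: "integrable \<mu> g" "integrable \<mu> g0"
    by (use gL in \<open>auto intro!: bounded_continuous_integrable assms(1,2) g g0 boundedI[of _ L]\<close>)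
  have [measurable]: "g \<in> borel_measurable \<mu>" using int_g(1) by (rule borel_measurable_integrable)
  have pt: "(m x - g x)\<^sup>2 \<le> 2 * (m x - ?mL x)\<^sup>2 + 4 * L * \<bar>?mL x - g0 x\<bar>" for x
  proof -
    have "(?mL x - g x)\<^sup>2 = \<bar>?mL x - g x\<bar> * \<bar>?mL x - g x\<bar>" by (simp add: power2_eq_square)
    also have "\<dots> \<le> (2 * L) * \<bar>?mL x - g0 x\<bar>"
    proof (rule mult_mono)
      show "\<bar>?mL x - g x\<bar> \<le> 2 * L" using clip_bound[of L "m x"] gL[of x] L by linarith
      show "\<bar>?mL x - g x\<bar> \<le> \<bar>?mL x - g0 x\<bar>"
        using clip_dist[of L "?mL x" "g0 x"] clip_id[of "?mL x" L] clip_bound[of L "m x"] L by (simp add: g_def)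
    qed (use L in auto)
    finally have "(?mL x - g x)\<^sup>2 \<le> 2 * L * \<bar>?mL x - g0 x\<bar>" .
    moreover have "(m x - g x)\<^sup>2 \<le> 2 * (m x - ?mL x)\<^sup>2 + 2 * (?mL x - g x)\<^sup>2"
      using zero_le_power2[of "(m x - ?mL x) - (?mL x - g x)"] by (simp add: power2_eq_square algebra_simps)
    ultimately show ?thesis by linarith
  qed
  have int_tail: "integrable \<mu> (\<lambda>x. (m x - ?mL x)\<^sup>2)"
    by (rule Bochner_Integration.integrable_bound[OF m2]) (use tail_le L in auto)
  have "(\<integral>\<^sup>+x. ennreal ((m x - g x)\<^sup>2) \<partial>\<mu>) \<le> (\<integral>\<^sup>+x. ennreal (2 * (m x - ?mL x)\<^sup>2 + 4 * L * \<bar>?mL x - g0 x\<bar>) \<partial>\<mu>)"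
    by (intro nn_integral_mono ennreal_leI pt)
  also have "\<dots> = ennreal (\<integral>x. 2 * (m x - ?mL x)\<^sup>2 + 4 * L * \<bar>?mL x - g0 x\<bar> \<partial>\<mu>)"
    using L int_tail by (intro nn_integral_eq_integral) auto
  also have "(\<integral>x. 2 * (m x - ?mL x)\<^sup>2 + 4 * L * \<bar>?mL x - g0 x\<bar> \<partial>\<mu>)
     = 2 * (\<integral>x. (m x - ?mL x)\<^sup>2 \<partial>\<mu>) + 4 * L * (\<integral>x. \<bar>?mL x - g0 x\<bar> \<partial>\<mu>)"
    using int_tail by (subst Bochner_Integration.integral_add) auto
  also have "ennreal \<dots> < ennreal e"
  proof (rule ennreal_lessI[OF e])
    have "4 * L * (\<integral>x. \<bar>?mL x - g0 x\<bar> \<partial>\<mu>) < 4 * L * (e / (8 * L))"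
      using g0 L by (intro mult_strict_left_mono) auto
    also have "\<dots> = e / 2" using L by simp
    finally show "2 * (\<integral>x. (m x - ?mL x)\<^sup>2 \<partial>\<mu>) + 4 * L * (\<integral>x. \<bar>?mL x - g0 x\<bar> \<partial>\<mu>) < e"
      using i(2) by (simp add: L_def)
  qed
  finally show ?thesis using that[of g L] g L gL by blast
qed

section \<open>Paths to the leaves and joint distributions\<close>

text \<open>Cells vary with the tree, whereas the paths of length k form one finite set that serves
  all complete trees of height k. They also belong to a countable type, which makes equality of two
  random labels an event.\<close>

primrec leaf_path :: "'d::finite cut_tree \<Rightarrow> real ^ 'd \<Rightarrow> bool list" where
  "leaf_path Leaf x = []"
| "leaf_path (Node l c r) x =
     (if x $ fst c < snd c then True # leaf_path l x else False # leaf_path r x)"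

lemma mem_leaf_cell_from_iff:
  "z \<in> leaf_cell_from A t x \<longleftrightarrow> z \<in> A \<and> leaf_path t z = leaf_path t x"
  by (induction t arbitrary: A) (auto simp: lower_part_def upper_part_def)

lemma mem_leaf_cell_iff: "z \<in> leaf_cell t x \<longleftrightarrow> z \<in> cbox 0 1 \<and> leaf_path t z = leaf_path t x"
  by (simp add: leaf_cell_def mem_leaf_cell_from_iff)

lemma length_leaf_path: "Tree.complete t \<Longrightarrow> length (leaf_path t x) = height t"
  by (induction t) auto

lemma card_bool_lists: "finite {p::bool list. length p = k}" "card {p::bool list. length p = k} = 2 ^ k"
  using card_lists_length_eq[of "UNIV :: bool set" k] finite_lists_length_eq[of "UNIV :: bool set" k]
  by auto

text \<open>The default \<open>c\<close> on a leaf makes the root cut a total function of the tree,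
  hence a measurable one; the conjunct \<open>t \<noteq> Leaf\<close> discards the artificial
  case.\<close>

lemma leaf_path_eq_Cons_iff:
  "leaf_path t x = b # p \<longleftrightarrow> t \<noteq> Leaf \<and>
     (x $ fst (case t of Leaf \<Rightarrow> c | Node l v r \<Rightarrow> v) < snd (case t of Leaf \<Rightarrow> c | Node l v r \<Rightarrow> v)) = b \<and>
     leaf_path (if b then Tree.left t else Tree.right t) x = p"
  by (cases t) auto

text \<open>The tree is itself random, so the induction runs over the value of the path, with the
  tree generalised: the subtrees below the root are again measurable functions of the
  parameter.\<close>

lemma measurable_leaf_path:
  fixes t :: "'b \<Rightarrow> 'd::finite cut_tree"
  assumes "t \<in> measurable B cut_tree_space" and x [measurable]: "x \<in> borel_measurable B"
  shows "(\<lambda>b. leaf_path (t b) (x b)) \<in> measurable B (count_space UNIV)"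
proof -
  have "Measurable.pred B (\<lambda>b. leaf_path (t b) (x b) = p)" for p
    using assms(1)
  proof (induction p arbitrary: t)
    case Nil
    then have [measurable]: "t \<in> measurable B (tree_sigma (count_space UNIV \<Otimes>\<^sub>M borel))"
      by (simp add: cut_tree_space_def)
    have "(\<lambda>b. leaf_path (t b) (x b) = []) = (\<lambda>b. t b \<in> {Leaf})"
      by (auto simp: fun_eq_iff split: tree.split if_splits) (metis leaf_path.simps(2) list.distinct(1) tree.exhaust)+
    also have "Measurable.pred B \<dots>" by measurable
    finally show ?case .
  next
    case (Cons b p)
    from Cons.prems have t [measurable]: "t \<in> measurable B (tree_sigma (count_space UNIV \<Otimes>\<^sub>M borel))"
      by (simp add: cut_tree_space_def)
    define v where "v s = (case s of Leaf \<Rightarrow> (undefined, 0) | Node l v r \<Rightarrow> v)" for s :: "'d cut_tree"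
    have [measurable]: "(\<lambda>b. v (t b)) \<in> measurable B (count_space UNIV \<Otimes>\<^sub>M borel)"
      unfolding v_def by measurable
    have v1: "(\<lambda>b. fst (v (t b))) \<in> measurable B (count_space UNIV)" by measurable
    have "(\<lambda>b. x b $ i) \<in> borel_measurable B" for i
      by (rule measurable_compose[OF x]) (intro borel_measurable_continuous_onI continuous_intros)
    \<comment> \<open>The index of the coordinate that is cut is random, but it ranges over a finite
      type.\<close>
    then have [measurable]: "(\<lambda>b. x b $ fst (v (t b))) \<in> borel_measurable B"
      using v1 by (rule measurable_compose_countable)
    have [measurable]: "Measurable.pred B (\<lambda>a. leaf_path (if b then Tree.left (t a) else Tree.right (t a)) (x a) = p)"
      by (rule Cons.IH) (simp add: cut_tree_space_def)
    have [measurable]: "Measurable.pred B (\<lambda>a. t a \<in> {Leaf})" by measurable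
    have "(\<lambda>a. leaf_path (t a) (x a) = b # p) = (\<lambda>a. \<not> t a \<in> {Leaf} \<and>
        (x a $ fst (v (t a)) < snd (v (t a))) = b \<and> leaf_path (if b then Tree.left (t a) else Tree.right (t a)) (x a) = p)"
      unfolding v_def by (subst leaf_path_eq_Cons_iff[where c="(undefined, 0)"]) simp
    also have "Measurable.pred B \<dots>" by measurable
    finally show ?case .
  qed
  then show ?thesis
    by (subst measurable_count_space_eq2_countable) (auto simp: pred_def vimage_def Int_def conj_commute)
qed

text \<open>The product rule on rectangles identifies the joint law with a product measure, and
  Fubini applies. It is stated for preimages because \<open>U\<close> and \<open>V\<close> have
  different types. Both orders are used: one freezes the tree, to bound its risk, the other freezes
  the sample, for Jensen's inequality.\<close>

lemma (in prob_space) nn_integral_independent_pair: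
  assumes U [measurable]: "U \<in> measurable M A" and V [measurable]: "V \<in> measurable M B"
    and ind: "\<And>a b. a \<in> sets A \<Longrightarrow> b \<in> sets B \<Longrightarrow>
      prob ((U -` a \<inter> space M) \<inter> (V -` b \<inter> space M)) = prob (U -` a \<inter> space M) * prob (V -` b \<inter> space M)"
    and F [measurable]: "F \<in> borel_measurable (A \<Otimes>\<^sub>M B)"
  shows "(\<integral>\<^sup>+\<omega>. F (U \<omega>, V \<omega>) \<partial>M) = (\<integral>\<^sup>+\<omega>. \<integral>\<^sup>+\<omega>'. F (U \<omega>, V \<omega>') \<partial>M \<partial>M)"
    and "(\<integral>\<^sup>+\<omega>. F (U \<omega>, V \<omega>) \<partial>M) = (\<integral>\<^sup>+\<omega>'. \<integral>\<^sup>+\<omega>. F (U \<omega>, V \<omega>') \<partial>M \<partial>M)"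
proof -
  interpret U: prob_space "distr M A U" by (rule prob_space_distr) fact
  interpret V: prob_space "distr M B V" by (rule prob_space_distr) fact
  interpret UV: pair_sigma_finite "distr M A U" "distr M B V" ..
  have eq: "distr M A U \<Otimes>\<^sub>M distr M B V = distr M (A \<Otimes>\<^sub>M B) (\<lambda>\<omega>. (U \<omega>, V \<omega>))"
  proof (rule pair_measure_eqI)
    show "sigma_finite_measure (distr M A U)" "sigma_finite_measure (distr M B V)" by unfold_locales
    fix a b assume ab: "a \<in> sets (distr M A U)" "b \<in> sets (distr M B V)"
    then have ab: "a \<in> sets A" "b \<in> sets B" by auto
    have "(\<lambda>\<omega>. (U \<omega>, V \<omega>)) -` (a \<times> b) \<inter> space M = (U -` a \<inter> space M) \<inter> (V -` b \<inter> space M)" by auto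
    then show "emeasure (distr M A U) a * emeasure (distr M B V) b
        = emeasure (distr M (A \<Otimes>\<^sub>M B) (\<lambda>\<omega>. (U \<omega>, V \<omega>))) (a \<times> b)"
      using ab ind[OF ab] by (simp add: emeasure_distr emeasure_eq_measure ennreal_mult)
  qed (simp cong: sets_pair_measure_cong)
  have "(\<integral>\<^sup>+\<omega>. F (U \<omega>, V \<omega>) \<partial>M) = (\<integral>\<^sup>+p. F p \<partial>(distr M A U \<Otimes>\<^sub>M distr M B V))"
    unfolding eq by (subst nn_integral_distr) auto
  also have "\<dots> = (\<integral>\<^sup>+u. \<integral>\<^sup>+v. F (u, v) \<partial>distr M B V \<partial>distr M A U)"
    by (rule V.nn_integral_fst[symmetric]) (simp cong: measurable_cong_sets sets_pair_measure_cong)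
  finally have *: "(\<integral>\<^sup>+\<omega>. F (U \<omega>, V \<omega>) \<partial>M) = (\<integral>\<^sup>+u. \<integral>\<^sup>+v. F (u, v) \<partial>distr M B V \<partial>distr M A U)" .
  have F': "F \<in> borel_measurable (distr M A U \<Otimes>\<^sub>M distr M B V)"
    by (simp cong: measurable_cong_sets sets_pair_measure_cong)
  have "(\<integral>\<^sup>+u. \<integral>\<^sup>+v. F (u, v) \<partial>distr M B V \<partial>distr M A U) = (\<integral>\<^sup>+\<omega>. \<integral>\<^sup>+v. F (U \<omega>, v) \<partial>distr M B V \<partial>M)"
    by (subst nn_integral_distr[OF U]) (use V.borel_measurable_nn_integral_fst[OF F'] in simp_all)
  also have "\<dots> = (\<integral>\<^sup>+\<omega>. \<integral>\<^sup>+\<omega>'. F (U \<omega>, V \<omega>') \<partial>M \<partial>M)"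
    by (intro nn_integral_cong nn_integral_distr[OF V]) (use measurable_space[OF U] in simp)
  finally show "(\<integral>\<^sup>+\<omega>. F (U \<omega>, V \<omega>) \<partial>M) = (\<integral>\<^sup>+\<omega>. \<integral>\<^sup>+\<omega>'. F (U \<omega>, V \<omega>') \<partial>M \<partial>M)"
    unfolding * .
  also have "\<dots> = (\<integral>\<^sup>+\<omega>'. \<integral>\<^sup>+\<omega>. F (U \<omega>, V \<omega>') \<partial>M \<partial>M)"
    by (rule pair_sigma_finite.Fubini') (unfold_locales, measurable)
  finally show "(\<integral>\<^sup>+\<omega>. F (U \<omega>, V \<omega>) \<partial>M) = (\<integral>\<^sup>+\<omega>'. \<integral>\<^sup>+\<omega>. F (U \<omega>, V \<omega>') \<partial>M \<partial>M)" .
qed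

section \<open>Joint law of the parameter, the observations and the query\<close>

locale random_sample = prob_space M for M :: "'w measure" +
  fixes X :: "'w \<Rightarrow> real ^ 'd::finite" and Y :: "'w \<Rightarrow> real"
    and Z :: "nat \<Rightarrow> 'w \<Rightarrow> (real ^ 'd) \<times> real"
    and N :: "'t measure" and \<Theta> :: "'w \<Rightarrow> 't"
  assumes X [measurable]: "X \<in> borel_measurable M" and Y [measurable]: "Y \<in> borel_measurable M"
    and Z [measurable]: "\<And>i. Z i \<in> borel_measurable M" and \<Theta> [measurable]: "\<Theta> \<in> measurable M N"
    and distr_Z: "\<And>i. distr M borel (Z i) = distr M borel (\<lambda>\<omega>. (X \<omega>, Y \<omega>))"
    and ind: "independent_sources M Z X N \<Theta>"
begin

definition P :: "((real ^ 'd) \<times> real) measure" where "P = distr M borel (\<lambda>\<omega>. (X \<omega>, Y \<omega>))"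

sublocale P: prob_space P unfolding P_def by (rule prob_space_distr) measurable

lemma sets_P [measurable_cong]: "sets P = sets borel" by (simp add: P_def)

lemma space_P [simp]: "space P = UNIV" by (simp add: P_def)

text \<open>The query is put in position \<open>n\<close>, behind the observations, with the dummy response \<open>0\<close>.\<close>

definition U :: "nat \<Rightarrow> nat \<Rightarrow> 'w \<Rightarrow> (real ^ 'd) \<times> real" where
  "U n i \<omega> = (if i < n then Z i \<omega> else (X \<omega>, 0))"

definition V :: "nat \<Rightarrow> 'w \<Rightarrow> nat \<Rightarrow> (real ^ 'd) \<times> real" where
  "V n \<omega> = (\<lambda>i\<in>{..n}. U n i \<omega>)"

lemma U_measurable [measurable]: "U n i \<in> borel_measurable M"
  unfolding U_def by measurable

lemma V_measurable [measurable]: "V n \<in> measurable M (PiM {..n} (\<lambda>_. borel))"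
  unfolding V_def by measurable

abbreviation source_events :: "source \<Rightarrow> 'w set set" where
  "source_events \<equiv> case_source (\<lambda>i. {Z i -` B \<inter> space M | B. B \<in> sets borel})
     {X -` B \<inter> space M | B. B \<in> sets borel} {\<Theta> -` B \<inter> space M | B. B \<in> sets N}"

definition src :: "nat \<Rightarrow> nat \<Rightarrow> source" where "src n i = (if i < n then Observation i else Query)"

lemma indep_source_events: "indep_sets source_events UNIV"
  using ind by (simp add: independent_sources_def)

lemma U_events: "{U n i -` B \<inter> space M | B. B \<in> sets borel} \<subseteq> source_events (src n i)"
proof (cases "i < n")
  case True
  then show ?thesis by (auto simp: src_def U_def)
next
  case False
  have "(\<lambda>x. (x, 0)) -` B \<in> sets borel" if "B \<in> sets borel" for B :: "((real ^ 'd) \<times> real) set"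
    using measurable_sets[of "\<lambda>x. (x, 0)" borel borel B] that by simp
  moreover have "U n i -` B \<inter> space M = X -` ((\<lambda>x. (x, 0)) -` B) \<inter> space M" for B
    using False by (auto simp: U_def)
  ultimately show ?thesis using False by (auto simp: src_def)
qed

lemma inj_src: "inj_on (src n) {..n}"
  by (auto simp: inj_on_def src_def split: if_splits)

text \<open>Each position draws on a source of its own, so independence of the sources is carried
  over along the injection \<open>src n\<close>.\<close>

lemma indep_U: "indep_vars (\<lambda>_. borel) (U n) {..n}"
  unfolding indep_vars_def2
proof (intro conjI ballI indep_setsI)
  show "U n i \<in> borel_measurable M" for i by measurable
  show "{U n i -` B \<inter> space M | B. B \<in> sets borel} \<subseteq> events" for i by auto
  fix A J assume J: "J \<noteq> {}" "J \<subseteq> {..n}" "finite J"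
    and A: "\<forall>j\<in>J. A j \<in> {U n j -` B \<inter> space M | B. B \<in> sets borel}"
  have inj: "inj_on (src n) J" using inj_src J(2) by (rule inj_on_subset)
  define A' where "A' s = A (the_inv_into J (src n) s)" for s
  have A': "A' (src n j) = A j" if "j \<in> J" for j
    using that inj by (simp add: A'_def the_inv_into_f_f)
  have "prob (\<Inter>s\<in>src n ` J. A' s) = (\<Prod>s\<in>src n ` J. prob (A' s))"
  proof (rule indep_setsD[OF indep_source_events])
    show "\<forall>s\<in>src n ` J. A' s \<in> source_events s"
    proof
      fix s assume "s \<in> src n ` J"
      then obtain j where j: "j \<in> J" "s = src n j" by blast
      with A have "A j \<in> {U n j -` B \<inter> space M | B. B \<in> sets borel}" by blast
      then show "A' s \<in> source_events s" using U_events[of n j] A'[OF j(1)] unfolding j(2) by auto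
    qed
  qed (use J in auto)
  then show "prob (\<Inter>j\<in>J. A j) = (\<Prod>j\<in>J. prob (A j))"
    using A' inj by (simp add: prod.reindex image_image)
qed

lemma Int_stable_preimages: "Int_stable {f -` B \<inter> space M | B. B \<in> sets K}"
proof (rule Int_stableI)
  fix a b assume "a \<in> {f -` B \<inter> space M | B. B \<in> sets K}" "b \<in> {f -` B \<inter> space M | B. B \<in> sets K}"
  then obtain A B where "A \<in> sets K" "a = f -` A \<inter> space M" "B \<in> sets K" "b = f -` B \<inter> space M" by blast
  then show "a \<inter> b \<in> {f -` B \<inter> space M | B. B \<in> sets K}"
    by (intro CollectI exI[of _ "A \<inter> B"]) auto
qed

text \<open>The sources fall into two disjoint blocks, one with the observations and the query, the
  other with the parameter. The sigma-algebras generated by the blocks are independent, and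
  \<open>V n\<close> is measurable with respect to the first.\<close>

lemma V_\<Theta>_indep:
  assumes a: "a \<in> sets (PiM {..n} (\<lambda>_. borel))" and b: "b \<in> sets N"
  shows "prob ((\<Theta> -` b \<inter> space M) \<inter> (V n -` a \<inter> space M)) = prob (\<Theta> -` b \<inter> space M) * prob (V n -` a \<inter> space M)"
proof -
  define I where "I = case_bool (insert Query (range Observation)) {Parameter}"
  define \<Sigma> where "\<Sigma> j = sigma_sets (space M) (\<Union>i\<in>I j. source_events i)" for j
  have "indep_sets \<Sigma> UNIV"
    unfolding \<Sigma>_def
  proof (rule indep_sets_collect_sigma)
    have "(\<Union>j. I j) = UNIV" by (auto simp: I_def UNIV_bool intro: source.exhaust)
    then show "indep_sets source_events (\<Union>j. I j)" using indep_source_events by simp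
    show "Int_stable (source_events i)" for i
      by (cases i) (simp_all add: Int_stable_preimages)
    show "disjoint_family_on I UNIV"
      by (auto simp: disjoint_family_on_def I_def split: bool.splits)
  qed
  moreover have "\<Theta> -` b \<inter> space M \<in> \<Sigma> False"
    unfolding \<Sigma>_def I_def using b by auto
  moreover have "V n -` a \<inter> space M \<in> \<Sigma> True"
  proof -
    let ?S = "sigma (space M) (\<Union>i\<in>I True. source_events i)"
    have sub: "(\<Union>i\<in>I True. source_events i) \<subseteq> Pow (space M)" by (auto simp: I_def)
    have Zm: "Z i \<in> measurable ?S borel" for i
      using sub by (intro measurableI) (auto simp: I_def)
    have Xm: "X \<in> measurable ?S borel"
      using sub by (intro measurableI) (auto simp: I_def)
    have "V n \<in> measurable ?S (PiM {..n} (\<lambda>_. borel))"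
      unfolding V_def U_def
    proof (rule measurable_restrict)
      show "(\<lambda>\<omega>. if i < n then Z i \<omega> else (X \<omega>, 0)) \<in> measurable ?S borel" for i
        using Zm[of i] Xm by (cases "i < n") (simp_all add: borel_measurable_Pair)
    qed
    from measurable_sets[OF this a] show ?thesis
      using sub by (simp add: \<Sigma>_def)
  qed
  ultimately show ?thesis
    using indep_setsD[of \<Sigma> UNIV UNIV "case_bool (V n -` a \<inter> space M) (\<Theta> -` b \<inter> space M)"]
    by (auto simp: UNIV_bool Int_commute mult.commute split: bool.splits)
qed

lemma distr_V: "distr M (PiM {..n} (\<lambda>_. borel)) (V n) = PiM {..n} (\<lambda>i. distr M borel (U n i))"
  using indep_U[of n] unfolding V_def by (subst (asm) indep_vars_iff_distr_eq_PiM) auto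

text \<open>The law of \<open>V n\<close> differs from the product measure in the response of the
  query alone, which is 0 instead of a copy of \<open>Y\<close>. A function that does not read this
  response cannot tell the two apart, so exchangeability of the product measure becomes
  available.\<close>

lemma nn_integral_V:
  assumes f [measurable]: "f \<in> borel_measurable (PiM {..n} (\<lambda>_. borel))"
    and irrelevant: "\<And>D x y. f (D(n := (x, y))) = f (D(n := (x, 0)))"
  shows "(\<integral>\<^sup>+\<omega>. f (V n \<omega>) \<partial>M) = (\<integral>\<^sup>+D. f D \<partial>PiM {..n} (\<lambda>_. P))"
proof -
  let ?Q = "\<lambda>i. distr M borel (U n i)"
  interpret Q: product_sigma_finite ?Q
    by (intro product_sigma_finite.intro prob_space_imp_sigma_finite prob_space_distr) measurable
  interpret PP: product_sigma_finite "\<lambda>_::nat. P" by unfold_locales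
  have ins: "insert n {..<n} = {..n}" by auto
  have fQ: "f \<in> borel_measurable (PiM (insert n {..<n}) ?Q)"
    unfolding ins using f by (simp cong: measurable_cong_sets sets_PiM_cong)
  have fP: "f \<in> borel_measurable (PiM (insert n {..<n}) (\<lambda>_. P))"
    unfolding ins using f by (simp add: sets_P cong: measurable_cong_sets sets_PiM_cong)
  have Q_eq: "PiM {..<n} ?Q = PiM {..<n} (\<lambda>_. P)"
    by (intro PiM_cong refl) (simp add: U_def P_def distr_Z cong: distr_cong)
  have fupd: "(\<lambda>y. f (D(n := y))) \<in> borel_measurable borel" if "D \<in> space (PiM {..<n} (\<lambda>_. P))" for D
  proof (rule measurable_compose[OF _ f])
    have "D(n := y) = (\<lambda>i\<in>{..n}. if i = n then y else D i)" for y
      using that by (auto simp: space_PiM fun_eq_iff PiE_def extensional_def)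
    then show "(\<lambda>y. D(n := y)) \<in> measurable borel (PiM {..n} (\<lambda>_. borel))"
      by (simp only:) (rule measurable_restrict, simp)
  qed
  have "(\<integral>\<^sup>+\<omega>. f (V n \<omega>) \<partial>M) = (\<integral>\<^sup>+D. f D \<partial>distr M (PiM {..n} (\<lambda>_. borel)) (V n))"
    by (rule nn_integral_distr[symmetric]) auto
  also have "\<dots> = (\<integral>\<^sup>+D. f D \<partial>PiM (insert n {..<n}) ?Q)" unfolding distr_V ins ..
  also have "\<dots> = (\<integral>\<^sup>+D. (\<integral>\<^sup>+y. f (D(n := y)) \<partial>?Q n) \<partial>PiM {..<n} (\<lambda>_. P))"
    by (subst Q.product_nn_integral_insert[OF _ _ fQ]) (auto simp: Q_eq)
  also have "\<dots> = (\<integral>\<^sup>+D. (\<integral>\<^sup>+y. f (D(n := y)) \<partial>P) \<partial>PiM {..<n} (\<lambda>_. P))"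
  proof (rule nn_integral_cong)
    fix D assume D: "D \<in> space (PiM {..<n} (\<lambda>_. P))"
    have "(\<integral>\<^sup>+y. f (D(n := y)) \<partial>?Q n) = (\<integral>\<^sup>+\<omega>. f (D(n := (X \<omega>, 0))) \<partial>M)"
      by (subst nn_integral_distr) (use fupd[OF D] in \<open>auto simp: U_def\<close>)
    also have "\<dots> = (\<integral>\<^sup>+\<omega>. f (D(n := (X \<omega>, Y \<omega>))) \<partial>M)" by (simp add: irrelevant[of D "X _" "Y _"])
    also have "\<dots> = (\<integral>\<^sup>+y. f (D(n := y)) \<partial>P)"
      unfolding P_def by (subst nn_integral_distr) (use fupd[OF D] in auto)
    finally show "(\<integral>\<^sup>+y. f (D(n := y)) \<partial>?Q n) = (\<integral>\<^sup>+y. f (D(n := y)) \<partial>P)" .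
  qed
  also have "\<dots> = (\<integral>\<^sup>+D. f D \<partial>PiM {..n} (\<lambda>_. P))"
    by (subst PP.product_nn_integral_insert[OF _ _ fP, unfolded ins]) auto
  finally show ?thesis .
qed

end

section \<open>Risk of a non-adaptive forest\<close>

text \<open>The gap between the two sides is the sum of the squared pairwise differences.\<close>

lemma square_sum_five_le:
  fixes a b c d e :: real
  shows "(a + b + c + d + e)\<^sup>2 \<le> 5 * (a\<^sup>2 + b\<^sup>2 + c\<^sup>2 + d\<^sup>2 + e\<^sup>2)"
proof -
  have "0 \<le> (a - b)\<^sup>2 + (a - c)\<^sup>2 + (a - d)\<^sup>2 + (a - e)\<^sup>2 + (b - c)\<^sup>2 + (b - d)\<^sup>2 + (b - e)\<^sup>2
      + (c - d)\<^sup>2 + (c - e)\<^sup>2 + (d - e)\<^sup>2" by simp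
  also have "\<dots> = 5 * (a\<^sup>2 + b\<^sup>2 + c\<^sup>2 + d\<^sup>2 + e\<^sup>2) - (a + b + c + d + e)\<^sup>2"
    by (simp add: power2_eq_square algebra_simps)
  finally show ?thesis by simp
qed

text \<open>Here \<open>u\<close> plays the regression function, \<open>v\<close> its continuous
  approximation, \<open>r\<close> the noise, and \<open>good\<close> says that the cell of the query
  is small. The error is split along y = r + (u - v) + (v - v n) + v n under the weights. If
  \<open>good\<close> fails, the oscillation of \<open>v\<close> is at most 2 L, whence 4
  L^2.\<close>

lemma weighted_estimate_error_le:
  fixes y r u v :: "nat \<Rightarrow> real"
  assumes y: "\<And>i. i < n \<Longrightarrow> y i = r i + u i" and L: "\<And>i. \<bar>v i\<bar> \<le> L"
    and close: "\<And>i. i < n \<Longrightarrow> l i = l n \<Longrightarrow> good \<Longrightarrow> \<bar>v i - v n\<bar> \<le> \<eta>"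
  shows "((\<Sum>i<n. weight n l i * y i) - u n)\<^sup>2 \<le>
    5 * ((\<Sum>i<n. weight n l i * r i)\<^sup>2 + (\<Sum>i<n. weight n l i * (u i - v i)\<^sup>2) +
      (\<eta>\<^sup>2 + 4 * L\<^sup>2 * of_bool (\<not> good)) + L\<^sup>2 * (1 - (\<Sum>i<n. weight n l i)) + (u n - v n)\<^sup>2)"
proof -
  let ?w = "weight n l"
  define s where "s = (\<Sum>i<n. ?w i)"
  have s: "s = 0 \<or> s = 1" by (simp add: s_def sum_weight)
  have "(\<Sum>i<n. ?w i * y i) = (\<Sum>i<n. ?w i * r i + ?w i * (u i - v i) + ?w i * (v i - v n) + v n * ?w i)"
    by (intro sum.cong refl) (simp add: y algebra_simps)
  also have "\<dots> = (\<Sum>i<n. ?w i * r i) + (\<Sum>i<n. ?w i * (u i - v i)) + (\<Sum>i<n. ?w i * (v i - v n)) + v n * s"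
    by (simp add: sum.distrib sum_distrib_left s_def)
  finally have eq: "(\<Sum>i<n. ?w i * y i) - u n = (\<Sum>i<n. ?w i * r i) + (\<Sum>i<n. ?w i * (u i - v i))
      + (\<Sum>i<n. ?w i * (v i - v n)) + v n * (s - 1) + (v n - u n)"
    by (simp add: algebra_simps)
  define B where "B = \<eta>\<^sup>2 + 4 * L\<^sup>2 * of_bool (\<not> good)"
  have B: "0 \<le> B" by (simp add: B_def)
  have "(\<Sum>i<n. ?w i * (v i - v n))\<^sup>2 \<le> (\<Sum>i<n. ?w i * (v i - v n)\<^sup>2)"
    by (rule weighted_mean_square_le)
  also have "\<dots> \<le> (\<Sum>i<n. ?w i * B)"
  proof (rule sum_mono)
    fix i assume "i \<in> {..<n}" then have i: "i < n" by simp
    show "?w i * (v i - v n)\<^sup>2 \<le> ?w i * B"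
    proof (cases "l i = l n")
      case True
      have "(v i - v n)\<^sup>2 \<le> B"
      proof (cases good)
        case good: True
        have "\<bar>v i - v n\<bar>\<^sup>2 \<le> \<eta>\<^sup>2" by (intro power_mono close i True good) simp
        then show ?thesis using good by (simp add: B_def)
      next
        case False
        have "\<bar>v i - v n\<bar>\<^sup>2 \<le> (2 * L)\<^sup>2"
          using L[of i] L[of n] by (intro power_mono) auto
        then have "(v i - v n)\<^sup>2 \<le> 4 * L\<^sup>2" by (simp add: power_mult_distrib)
        moreover have "0 \<le> \<eta>\<^sup>2" by (rule zero_le_power2)
        ultimately have "(v i - v n)\<^sup>2 \<le> \<eta>\<^sup>2 + 4 * L\<^sup>2" by linarith
        then show ?thesis using False by (simp add: B_def)
      qed
      then show ?thesis by (intro mult_left_mono) auto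
    qed (simp add: weight_def)
  qed
  also have "\<dots> = B * s" by (simp add: s_def sum_distrib_left mult.commute)
  also have "\<dots> \<le> B" using s B by auto
  finally have c: "(\<Sum>i<n. ?w i * (v i - v n))\<^sup>2 \<le> B" .
  \<comment> \<open>\<open>s\<close> is 0 or 1, so (s - 1)^2 = 1 - s and the term is linear in the
    missing weight.\<close>
  have "(v n * (s - 1))\<^sup>2 = (v n)\<^sup>2 * (1 - s)" using s by auto
  also have "\<dots> \<le> L\<^sup>2 * (1 - s)"
    using s L[of n] by (intro mult_right_mono) (auto simp: abs_le_square_iff[symmetric] intro: order_trans[OF _ abs_ge_self])
  finally have d: "(v n * (s - 1))\<^sup>2 \<le> L\<^sup>2 * (1 - s)" .
  have "((\<Sum>i<n. ?w i * y i) - u n)\<^sup>2 \<le> 5 * ((\<Sum>i<n. ?w i * r i)\<^sup>2 + (\<Sum>i<n. ?w i * (u i - v i))\<^sup>2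
      + (\<Sum>i<n. ?w i * (v i - v n))\<^sup>2 + (v n * (s - 1))\<^sup>2 + (v n - u n)\<^sup>2)"
    unfolding eq by (rule square_sum_five_le)
  also have "\<dots> \<le> 5 * ((\<Sum>i<n. ?w i * r i)\<^sup>2 + (\<Sum>i<n. ?w i * (u i - v i)\<^sup>2)
      + B + L\<^sup>2 * (1 - s) + (u n - v n)\<^sup>2)"
    by (intro mult_left_mono add_mono order_refl c d weighted_mean_square_le)
       (simp_all add: power2_commute)
  finally show ?thesis unfolding B_def s_def .
qed

lemma square_tail_small:
  fixes r :: "'a \<Rightarrow> real"
  assumes r: "r \<in> borel_measurable P" and r2: "integrable P (\<lambda>z. (r z)\<^sup>2)" and e: "0 < e"
  obtains L where "0 \<le> L" "(\<integral>\<^sup>+z. ennreal (max 0 ((r z)\<^sup>2 - L)) \<partial>P) \<le> ennreal e"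
proof -
  let ?h = "\<lambda>i z. max 0 ((r z)\<^sup>2 - real i)"
  have [measurable]: "r \<in> borel_measurable P" by (rule r)
  have "(\<lambda>i. \<integral>z. ?h i z \<partial>P) \<longlonglongrightarrow> (\<integral>z. 0 \<partial>P)"
  proof (rule integral_dominated_convergence[OF _ _ r2])
    show "AE z in P. (\<lambda>i. ?h i z) \<longlonglongrightarrow> 0"
    proof (rule AE_I2)
      fix z
      obtain k :: nat where "(r z)\<^sup>2 \<le> real k" using real_arch_simple by blast
      then have "?h i z = 0" if "k \<le> i" for i using that by simp
      then have "\<forall>\<^sub>F i in sequentially. ?h i z = 0" by (rule eventually_sequentiallyI)
      then show "(\<lambda>i. ?h i z) \<longlonglongrightarrow> 0" by (rule tendsto_eventually)
    qed
  qed auto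
  then have "\<forall>\<^sub>F i in sequentially. (\<integral>z. ?h i z \<partial>P) < e"
    using e by (intro order_tendstoD(2)) auto
  then obtain i where i: "(\<integral>z. ?h i z \<partial>P) < e" by (auto simp: eventually_sequentially)
  have "integrable P (?h i)"
    by (rule Bochner_Integration.integrable_bound[OF r2]) auto
  then have "(\<integral>\<^sup>+z. ennreal (?h i z) \<partial>P) = ennreal (\<integral>z. ?h i z \<partial>P)"
    by (rule nn_integral_eq_integral) simp
  also have "\<dots> \<le> ennreal e" using i by (intro ennreal_leI) simp
  finally show ?thesis using that[of "real i"] by simp
qed

locale non_adaptive_forest = random_sample M X Y Z N \<Theta>
  for M :: "'w measure" and X :: "'w \<Rightarrow> real ^ 'd::finite" and Y :: "'w \<Rightarrow> real"
    and Z :: "nat \<Rightarrow> 'w \<Rightarrow> (real ^ 'd) \<times> real" and N :: "'t measure" and \<Theta> :: "'w \<Rightarrow> 't" +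
  fixes T :: "nat \<Rightarrow> 't \<Rightarrow> 'd cut_tree" and k :: "nat \<Rightarrow> nat" and m :: "real ^ 'd \<Rightarrow> real"
  assumes X_cube: "\<And>\<omega>. \<omega> \<in> space M \<Longrightarrow> X \<omega> \<in> cbox 0 1"
    and Z_cube: "\<And>i \<omega>. \<omega> \<in> space M \<Longrightarrow> fst (Z i \<omega>) \<in> cbox 0 1"
    and Y_square: "integrable M (\<lambda>\<omega>. (Y \<omega>)\<^sup>2)"
    and regression: "regression_function M X Y m"
    and non_adaptive: "totally_non_adaptive N T k"
begin

lemma m_measurable [measurable]: "m \<in> borel_measurable borel"
  using regression by (simp add: regression_function_def)

lemma T_measurable: "T n \<in> measurable N cut_tree_space"
  using non_adaptive by (simp add: totally_non_adaptive_def)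

lemma fst_measurable [measurable]: "fst \<in> borel_measurable (borel :: ((real ^ 'd) \<times> real) measure)"
  by (intro borel_measurable_continuous_onI continuous_intros)

lemma snd_measurable [measurable]: "snd \<in> borel_measurable (borel :: ((real ^ 'd) \<times> real) measure)"
  by (intro borel_measurable_continuous_onI continuous_intros)

lemma Y_integrable: "integrable M Y"
  by (rule square_integrable_imp_integrable[OF Y Y_square])

lemma regression_AE: "AE \<omega> in M. real_cond_exp M (vimage_algebra (space M) X borel) Y \<omega> = m (X \<omega>)"
  using regression by (simp add: regression_function_def)

lemma sigma_finite_subalgebra_X: "sigma_finite_subalgebra M (vimage_algebra (space M) X borel)"
  by (rule finite_measure_subalgebra_is_sigma_finite)
     (unfold_locales, auto simp: subalgebra_def sets_vimage_algebra2)

text \<open>Conditional Jensen: the square of E[Y | X] is at most E[Y^2 | X], whose expectation is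
  finite.\<close>

lemma m_square: "integrable M (\<lambda>\<omega>. (m (X \<omega>))\<^sup>2)"
proof -
  let ?F = "vimage_algebra (space M) X borel"
  interpret F: sigma_finite_subalgebra M ?F by (rule sigma_finite_subalgebra_X)
  have "convex_on UNIV (\<lambda>x::real. x\<^sup>2)" by (rule convex_power2)
  then have "AE \<omega> in M. (real_cond_exp M ?F Y \<omega>)\<^sup>2 \<le> real_cond_exp M ?F (\<lambda>\<omega>. (Y \<omega>)\<^sup>2) \<omega>"
    using F.real_cond_exp_jensens_inequality(2)[OF Y_integrable, of UNIV _ _ "\<lambda>x. x\<^sup>2"] Y_square by auto
  with regression_AE have le: "AE \<omega> in M. norm ((m (X \<omega>))\<^sup>2) \<le> norm (real_cond_exp M ?F (\<lambda>\<omega>. (Y \<omega>)\<^sup>2) \<omega>)"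
    by eventually_elim auto
  show ?thesis
    by (rule Bochner_Integration.integrable_bound[OF F.real_cond_exp_int(1)[OF Y_square] _ le]) measurable
qed

lemma m_integrable: "integrable M (\<lambda>\<omega>. m (X \<omega>))"
  by (rule square_integrable_imp_integrable[OF _ m_square]) measurable

text \<open>The indicator is measurable with respect to the sigma-algebra of \<open>X\<close>, so
  the conditional expectation may be replaced by \<open>Y\<close>. Such test functions suffice:
  labels are functions of \<open>X\<close>.\<close>

lemma regression_orthogonal:
  assumes B [measurable]: "B \<in> sets borel"
  shows "(\<integral>\<omega>. indicator B (X \<omega>) * (Y \<omega> - m (X \<omega>)) \<partial>M) = 0"
proof -
  let ?F = "vimage_algebra (space M) X borel"
  interpret F: sigma_finite_subalgebra M ?F by (rule sigma_finite_subalgebra_X)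
  have int: "integrable M (\<lambda>\<omega>. indicator B (X \<omega>) * f \<omega>)" if "integrable M f" for f :: "'w \<Rightarrow> real"
    by (rule Bochner_Integration.integrable_bound[OF that]) (use that in \<open>auto simp: indicator_def\<close>)
  have XF: "X \<in> measurable ?F borel" by (rule measurable_vimage_algebra1) auto
  have IF: "(\<lambda>\<omega>. indicator B (X \<omega>) :: real) \<in> borel_measurable ?F"
    by (rule measurable_compose[OF XF]) measurable
  have "(\<integral>\<omega>. indicator B (X \<omega>) * m (X \<omega>) \<partial>M) = (\<integral>\<omega>. indicator B (X \<omega>) * real_cond_exp M ?F Y \<omega> \<partial>M)"
    by (rule integral_cong_AE) (use regression_AE in auto)
  also have "\<dots> = (\<integral>\<omega>. indicator B (X \<omega>) * Y \<omega> \<partial>M)"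
    by (rule F.real_cond_exp_intg(2)[OF int[OF Y_integrable] IF Y])
  finally show ?thesis
    using int[OF Y_integrable] int[OF m_integrable] by (simp add: right_diff_distrib)
qed

definition noise :: "(real ^ 'd) \<times> real \<Rightarrow> real" where "noise z = snd z - m (fst z)"

lemma noise_measurable [measurable]: "noise \<in> borel_measurable borel"
  unfolding noise_def by measurable

lemma noise_square: "integrable P (\<lambda>z. (noise z)\<^sup>2)"
proof -
  have "integrable M (\<lambda>\<omega>. (Y \<omega> - m (X \<omega>))\<^sup>2)"
  proof (rule Bochner_Integration.integrable_bound)
    show "integrable M (\<lambda>\<omega>. 2 * (Y \<omega>)\<^sup>2 + 2 * (m (X \<omega>))\<^sup>2)" using Y_square m_square by simp
    have "(a - b)\<^sup>2 \<le> 2 * a\<^sup>2 + 2 * b\<^sup>2" for a b :: real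
      using zero_le_power2[of "a + b"] by (simp add: power2_eq_square algebra_simps)
    then show "AE \<omega> in M. norm ((Y \<omega> - m (X \<omega>))\<^sup>2) \<le> norm (2 * (Y \<omega>)\<^sup>2 + 2 * (m (X \<omega>))\<^sup>2)" by simp
  qed measurable
  then show ?thesis unfolding P_def by (subst integrable_distr_eq) (auto simp: noise_def)
qed

lemma noise_orthogonal: "(\<integral>z. of_bool (leaf_path (T n \<theta>) (fst z) = c) * noise z \<partial>P) = 0" if "\<theta> \<in> space N"
proof -
  have "(\<lambda>x. leaf_path (T n \<theta>) x) \<in> measurable borel (count_space UNIV)"
    by (rule measurable_leaf_path) (use measurable_space[OF T_measurable that] in auto)
  then have "{x. leaf_path (T n \<theta>) x = c} \<in> sets borel"
    by (auto dest: measurable_sets[of _ _ _ "{c}"] simp: vimage_def)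
  from regression_orthogonal[OF this]
  have "(\<integral>\<omega>. of_bool (leaf_path (T n \<theta>) (X \<omega>) = c) * (Y \<omega> - m (X \<omega>)) \<partial>M) = 0"
    by (simp add: indicator_def)
  moreover have [measurable]: "(\<lambda>z. of_bool (leaf_path (T n \<theta>) (fst z) = c) * noise z) \<in> borel_measurable borel"
  proof -
    have "(indicator {x. leaf_path (T n \<theta>) x = c} :: _ \<Rightarrow> real) \<in> borel_measurable (borel :: (real ^ 'd) measure)"
      using \<open>{x. leaf_path (T n \<theta>) x = c} \<in> sets borel\<close> by (rule borel_measurable_indicator)
    from measurable_compose[OF fst_measurable this]
    have "(\<lambda>z :: (real ^ 'd) \<times> real. of_bool (leaf_path (T n \<theta>) (fst z) = c) :: real) \<in> borel_measurable borel"
      by (simp add: indicator_def)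
    then show ?thesis by measurable
  qed
  ultimately show ?thesis
    unfolding P_def by (subst integral_distr) (auto simp: noise_def)
qed

definition leaf_paths :: "nat \<Rightarrow> 't \<Rightarrow> (nat \<Rightarrow> (real ^ 'd) \<times> real) \<Rightarrow> nat \<Rightarrow> bool list" where
  "leaf_paths n \<theta> D i = leaf_path (T n \<theta>) (fst (D i))"

text \<open>No label depends on the response of the query; this is what meets the condition
  \<open>irrelevant\<close> in the bounds below.\<close>

lemma leaf_paths_upd: "leaf_paths n \<theta> (D(n := (x, y))) = (leaf_paths n \<theta> D)(n := leaf_path (T n \<theta>) x)"
  by (auto simp: leaf_paths_def)

abbreviation "sample_space n \<equiv> N \<Otimes>\<^sub>M PiM {..n} (\<lambda>_. borel :: ((real ^ 'd) \<times> real) measure)"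

lemma coordinate_measurable [measurable]:
  "i \<le> n \<Longrightarrow> (\<lambda>p. snd p i) \<in> borel_measurable (sample_space n)"
  by measurable

lemma weight_measurable_joint [measurable]:
  assumes "i \<le> n"
  shows "(\<lambda>p. weight n (leaf_paths n (fst p) (snd p)) i) \<in> borel_measurable (sample_space n)"
proof (rule measurable_weight[OF _ assms])
  fix j assume j: "j \<le> n"
  show "(\<lambda>p. leaf_paths n (fst p) (snd p) j) \<in> measurable (sample_space n) (count_space UNIV)"
    unfolding leaf_paths_def
  proof (rule measurable_leaf_path)
    show "(\<lambda>p. T n (fst p)) \<in> measurable (sample_space n) cut_tree_space"
      by (rule measurable_compose[OF measurable_fst T_measurable])
    show "(\<lambda>p. fst (snd p j)) \<in> borel_measurable (sample_space n)"
      by (rule measurable_compose[OF coordinate_measurable[OF j] fst_measurable])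
  qed
qed

text \<open>Completeness and the prescribed height enter here: every path has length
  \<open>k n\<close>, so 2 ^ k n labels suffice for every value of the parameter.\<close>

lemma labelled_sample_path:
  assumes "\<theta> \<in> space N"
  shows "labelled_sample P (\<lambda>z. leaf_path (T n \<theta>) (fst z)) {p. length p = k n}"
proof
  have "(\<lambda>z :: (real ^ 'd) \<times> real. leaf_path (T n \<theta>) (fst z)) \<in> measurable borel (count_space UNIV)"
    by (rule measurable_leaf_path) (use measurable_space[OF T_measurable assms] in auto)
  then show "(\<lambda>z. leaf_path (T n \<theta>) (fst z)) \<in> measurable P (count_space UNIV)"
    by (simp cong: measurable_cong_sets add: sets_P)
  show "leaf_path (T n \<theta>) (fst z) \<in> {p. length p = k n}" for z
    using non_adaptive assms by (simp add: totally_non_adaptive_def length_leaf_path)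
qed (rule card_bool_lists)

lemma lab_eq_leaf_paths:
  assumes "\<theta> \<in> space N"
  shows "labelled_sample.lab (\<lambda>z. leaf_path (T n \<theta>) (fst z)) = leaf_paths n \<theta>"
  by (intro ext, unfold leaf_paths_def) (rule labelled_sample.lab_def[OF labelled_sample_path[OF assms]])

lemma nn_integral_\<Theta>_V:
  assumes F: "F \<in> borel_measurable (sample_space n)"
  shows "(\<integral>\<^sup>+\<omega>. F (\<Theta> \<omega>, V n \<omega>) \<partial>M) = (\<integral>\<^sup>+\<omega>. \<integral>\<^sup>+\<omega>'. F (\<Theta> \<omega>, V n \<omega>') \<partial>M \<partial>M)"
    "(\<integral>\<^sup>+\<omega>. F (\<Theta> \<omega>, V n \<omega>) \<partial>M) = (\<integral>\<^sup>+\<omega>'. \<integral>\<^sup>+\<omega>. F (\<Theta> \<omega>, V n \<omega>') \<partial>M \<partial>M)"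
  by (rule nn_integral_independent_pair[OF \<Theta> V_measurable _ F]; rule V_\<Theta>_indep; assumption)+

text \<open>Independence allows the parameter to be frozen, and a bound that is uniform over all
  trees survives the average over \<Theta>.\<close>

lemma nn_integral_forest_le:
  assumes F: "F \<in> borel_measurable (sample_space n)"
    and irrelevant: "\<And>\<theta> D x y. F (\<theta>, D(n := (x, y))) = F (\<theta>, D(n := (x, 0)))"
    and bound: "\<And>\<theta>. \<theta> \<in> space N \<Longrightarrow> (\<integral>\<^sup>+D. F (\<theta>, D) \<partial>PiM {..n} (\<lambda>_. P)) \<le> c"
  shows "(\<integral>\<^sup>+\<omega>. F (\<Theta> \<omega>, V n \<omega>) \<partial>M) \<le> c"
proof -
  have "(\<integral>\<^sup>+\<omega>. F (\<Theta> \<omega>, V n \<omega>) \<partial>M) = (\<integral>\<^sup>+\<omega>. \<integral>\<^sup>+\<omega>'. F (\<Theta> \<omega>, V n \<omega>') \<partial>M \<partial>M)"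
    by (rule nn_integral_\<Theta>_V(1)[OF F])
  also have "\<dots> \<le> (\<integral>\<^sup>+\<omega>. c \<partial>M)"
  proof (rule nn_integral_mono)
    fix \<omega> assume "\<omega> \<in> space M"
    then have \<theta>: "\<Theta> \<omega> \<in> space N" by (rule measurable_space[OF \<Theta>])
    have "(\<lambda>D. F (\<Theta> \<omega>, D)) \<in> borel_measurable (PiM {..n} (\<lambda>_. borel))"
      by (rule measurable_Pair2[OF F \<theta>])
    then have "(\<integral>\<^sup>+\<omega>'. F (\<Theta> \<omega>, V n \<omega>') \<partial>M) = (\<integral>\<^sup>+D. F (\<Theta> \<omega>, D) \<partial>PiM {..n} (\<lambda>_. P))"
      by (rule nn_integral_V) (rule irrelevant)
    then show "(\<integral>\<^sup>+\<omega>'. F (\<Theta> \<omega>, V n \<omega>') \<partial>M) \<le> c" using bound[OF \<theta>] by simp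
  qed
  also have "\<dots> = c" by (simp add: emeasure_space_1)
  finally show ?thesis .
qed

definition est :: "nat \<Rightarrow> 't \<Rightarrow> (nat \<Rightarrow> (real ^ 'd) \<times> real) \<Rightarrow> real" where
  "est n \<theta> D = (\<Sum>i<n. weight n (leaf_paths n \<theta> D) i * snd (D i))"

lemma V_simps [simp]: "i < n \<Longrightarrow> V n \<omega> i = Z i \<omega>" "V n \<omega> n = (X \<omega>, 0)"
  by (simp_all add: V_def U_def)

text \<open>A point lies in the cell when it lies in the cube and has the path of the query; the
  observations satisfy the first condition by \<open>Z_cube\<close>. An empty cell gives 0 on both
  sides.\<close>

lemma tree_estimate_eq:
  assumes "\<omega> \<in> space M"
  shows "tree_estimate n (T n \<theta>) (\<lambda>i. Z i \<omega>) (X \<omega>) = est n \<theta> (V n \<omega>)"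
proof -
  let ?l = "leaf_paths n \<theta> (V n \<omega>)"
  have mem: "fst (Z i \<omega>) \<in> leaf_cell (T n \<theta>) (X \<omega>) \<longleftrightarrow> ?l i = ?l n" if "i < n" for i
    using Z_cube[OF assms] that by (simp add: mem_leaf_cell_iff leaf_paths_def)
  have "real (card {i. i < n \<and> fst (Z i \<omega>) \<in> leaf_cell (T n \<theta>) (X \<omega>)}) = hits {..<n} ?l n"
    using mem by (auto simp: hits_eq_card intro!: arg_cong[where f=card])
  moreover have "(\<Sum>i<n. snd (Z i \<omega>) * indicator (leaf_cell (T n \<theta>) (X \<omega>)) (fst (Z i \<omega>)))
      = (\<Sum>i<n. of_bool (?l i = ?l n) * snd (Z i \<omega>))"
    by (intro sum.cong refl) (simp add: mem indicator_def)
  moreover have "est n \<theta> (V n \<omega>) = (\<Sum>i<n. of_bool (?l i = ?l n) * snd (Z i \<omega>)) / hits {..<n} ?l n"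
    unfolding est_def weight_def sum_divide_distrib by (intro sum.cong refl) simp
  ultimately show ?thesis
    unfolding tree_estimate_def by (simp only:)
qed

lemma est_measurable [measurable]: "(\<lambda>p. est n (fst p) (snd p)) \<in> borel_measurable (sample_space n)"
  unfolding est_def
proof (rule borel_measurable_sum)
  fix i assume "i \<in> {..<n}"
  then have i: "i \<le> n" by simp
  show "(\<lambda>p. weight n (leaf_paths n (fst p) (snd p)) i * snd (snd p i)) \<in> borel_measurable (sample_space n)"
    by (intro borel_measurable_times weight_measurable_joint i
        measurable_compose[OF coordinate_measurable[OF i] snd_measurable])
qed

text \<open>The bound does not involve \<open>\<theta>\<close>: for a frozen sample the estimate is
  bounded in the parameter, so that it and its square are integrable over \<Theta>.\<close>

lemma abs_est_le: "\<bar>est n \<theta> D\<bar> \<le> (\<Sum>i<n. \<bar>snd (D i)\<bar>)"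
proof -
  have "\<bar>est n \<theta> D\<bar> \<le> (\<Sum>i<n. \<bar>weight n (leaf_paths n \<theta> D) i * snd (D i)\<bar>)"
    unfolding est_def by (rule sum_abs)
  also have "\<dots> \<le> (\<Sum>i<n. \<bar>snd (D i)\<bar>)"
    by (intro sum_mono) (simp add: abs_mult mult_left_le_one_le weight_le_1)
  finally show ?thesis .
qed

text \<open>The forest estimate integrates over a second copy of the probability space, which enters
  through \<Theta> alone. Jensen's inequality is applied on that copy with sample and query frozen;
  Fubini then merges the two copies into one.\<close>

lemma forest_risk_le:
  "forest_risk M \<Theta> T Z X m n \<le> (\<integral>\<^sup>+\<omega>. ennreal ((est n (\<Theta> \<omega>) (V n \<omega>) - m (X \<omega>))\<^sup>2) \<partial>M)"
proof -
  let ?F = "\<lambda>p. ennreal ((est n (fst p) (snd p) - m (fst (snd p n)))\<^sup>2)"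
  have [measurable]: "(\<lambda>p. m (fst (snd p n))) \<in> borel_measurable (sample_space n)"
    by (rule measurable_compose[OF coordinate_measurable[OF order_refl]]) measurable
  have F: "?F \<in> borel_measurable (sample_space n)" by measurable
  have "forest_risk M \<Theta> T Z X m n \<le> (\<integral>\<^sup>+\<omega>. \<integral>\<^sup>+\<omega>'. ?F (\<Theta> \<omega>', V n \<omega>) \<partial>M \<partial>M)"
    unfolding forest_risk_def
  proof (rule nn_integral_mono)
    fix \<omega> assume \<omega>: "\<omega> \<in> space M"
    let ?f = "\<lambda>\<omega>'. est n (\<Theta> \<omega>') (V n \<omega>) - m (X \<omega>)"
    let ?b = "(\<Sum>i<n. \<bar>snd (V n \<omega> i)\<bar>) + \<bar>m (X \<omega>)\<bar>"
    have "V n \<omega> \<in> space (PiM {..n} (\<lambda>_. borel))" by (rule measurable_space[OF V_measurable \<omega>])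
    then have "(\<lambda>\<theta>. est n \<theta> (V n \<omega>)) \<in> borel_measurable N"
      using measurable_Pair1[OF est_measurable] by simp
    then have est_m [measurable]: "(\<lambda>\<omega>'. est n (\<Theta> \<omega>') (V n \<omega>)) \<in> borel_measurable M"
      by (rule measurable_compose[OF \<Theta>])
    have b: "\<bar>?f \<omega>'\<bar> \<le> ?b" for \<omega>'
      using abs_est_le[of n "\<Theta> \<omega>'" "V n \<omega>"] by linarith
    have int_est: "integrable M (\<lambda>\<omega>'. est n (\<Theta> \<omega>') (V n \<omega>))"
      by (rule integrable_const_bound[OF _ est_m]) (use abs_est_le in auto)
    have int_f: "integrable M ?f" using int_est by simp
    have int_f2: "integrable M (\<lambda>\<omega>'. (?f \<omega>')\<^sup>2)"
    proof (rule integrable_const_bound[of _ "?b\<^sup>2"])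
      show "AE \<omega>' in M. norm ((?f \<omega>')\<^sup>2) \<le> ?b\<^sup>2"
        using b by (intro AE_I2) (simp add: abs_le_square_iff[symmetric] order_trans[OF _ abs_ge_self])
    qed measurable
    have "infinite_forest_estimate M \<Theta> T n (\<lambda>i. Z i \<omega>) (X \<omega>) - m (X \<omega>) = (\<integral>\<omega>'. ?f \<omega>' \<partial>M)"
      using int_est by (simp add: infinite_forest_estimate_def tree_estimate_eq[OF \<omega>] prob_space)
    moreover have "(\<integral>\<omega>'. ?f \<omega>' \<partial>M)\<^sup>2 \<le> (\<integral>\<omega>'. (?f \<omega>')\<^sup>2 \<partial>M)"
      using jensens_inequality[OF int_f, of UNIV _ _ "\<lambda>x. x\<^sup>2"] int_f2 convex_power2 by auto
    ultimately have "ennreal ((infinite_forest_estimate M \<Theta> T n (\<lambda>i. Z i \<omega>) (X \<omega>) - m (X \<omega>))\<^sup>2)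
        \<le> ennreal (\<integral>\<omega>'. (?f \<omega>')\<^sup>2 \<partial>M)"
      by (simp add: ennreal_leI)
    also have "\<dots> = (\<integral>\<^sup>+\<omega>'. ?F (\<Theta> \<omega>', V n \<omega>) \<partial>M)"
      using int_f2 by (subst nn_integral_eq_integral) auto
    finally show "ennreal ((infinite_forest_estimate M \<Theta> T n (\<lambda>i. Z i \<omega>) (X \<omega>) - m (X \<omega>))\<^sup>2)
        \<le> (\<integral>\<^sup>+\<omega>'. ?F (\<Theta> \<omega>', V n \<omega>) \<partial>M)" .
  qed
  also have "\<dots> = (\<integral>\<^sup>+\<omega>. ?F (\<Theta> \<omega>, V n \<omega>) \<partial>M)"
    by (rule nn_integral_\<Theta>_V(2)[OF F, symmetric])
  finally show ?thesis by simp
qed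

section \<open>Bounds for the random tree\<close>

lemma measurable_weighted_sum:
  assumes h: "h \<in> borel_measurable borel"
  shows "(\<lambda>p. \<Sum>i<n. weight n (leaf_paths n (fst p) (snd p)) i * h (snd p i)) \<in> borel_measurable (sample_space n)"
proof (rule borel_measurable_sum)
  fix i assume "i \<in> {..<n}"
  then have i: "i \<le> n" by simp
  show "(\<lambda>p. weight n (leaf_paths n (fst p) (snd p)) i * h (snd p i)) \<in> borel_measurable (sample_space n)"
    by (intro borel_measurable_times weight_measurable_joint i
        measurable_compose[OF coordinate_measurable[OF i] h])
qed

lemma noise_le:
  assumes "0 \<le> L"
  shows "(\<integral>\<^sup>+\<omega>. ennreal ((\<Sum>i<n. weight n (leaf_paths n (\<Theta> \<omega>) (V n \<omega>)) i * noise (V n \<omega> i))\<^sup>2) \<partial>M)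
    \<le> ennreal (2 * L) * ennreal (2 ^ k n / real (n + 1)) + 2 * (\<integral>\<^sup>+z. ennreal (max 0 ((noise z)\<^sup>2 - L)) \<partial>P)"
proof -
  let ?F = "\<lambda>p. ennreal ((\<Sum>i<n. weight n (leaf_paths n (fst p) (snd p)) i * noise (snd p i))\<^sup>2)"
  have "(\<integral>\<^sup>+\<omega>. ?F (\<Theta> \<omega>, V n \<omega>) \<partial>M)
    \<le> ennreal (2 * L) * ennreal (2 ^ k n / real (n + 1)) + 2 * (\<integral>\<^sup>+z. ennreal (max 0 ((noise z)\<^sup>2 - L)) \<partial>P)"
  proof (rule nn_integral_forest_le)
    show "?F \<in> borel_measurable (sample_space n)"
      using measurable_weighted_sum[OF noise_measurable] by measurable
    show "?F (\<theta>, D(n := (x, y))) = ?F (\<theta>, D(n := (x, 0)))" for \<theta> D x y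
      by (simp add: leaf_paths_upd cong: sum.cong_simp)
    fix \<theta> assume \<theta>: "\<theta> \<in> space N"
    show "(\<integral>\<^sup>+D. ?F (\<theta>, D) \<partial>PiM {..n} (\<lambda>_. P)) \<le> ennreal (2 * L) * ennreal (2 ^ k n / real (n + 1))
        + 2 * (\<integral>\<^sup>+z. ennreal (max 0 ((noise z)\<^sup>2 - L)) \<partial>P)"
      using labelled_sample.nn_integral_noise_le[OF labelled_sample_path[OF \<theta>, of n] _ noise_square
          noise_orthogonal[OF \<theta>] assms, of n] noise_measurable
      by (simp add: lab_eq_leaf_paths[OF \<theta>] card_bool_lists sets_P cong: measurable_cong_sets)
  qed
  then show ?thesis by simp
qed

lemma approximation_le:
  assumes h: "h \<in> borel_measurable borel" "\<And>x. 0 \<le> h x"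
  shows "(\<integral>\<^sup>+\<omega>. ennreal (\<Sum>i<n. weight n (leaf_paths n (\<Theta> \<omega>) (V n \<omega>)) i * h (fst (V n \<omega> i))) \<partial>M)
    \<le> 2 * (\<integral>\<^sup>+\<omega>. ennreal (h (X \<omega>)) \<partial>M)"
proof -
  let ?F = "\<lambda>p. ennreal (\<Sum>i<n. weight n (leaf_paths n (fst p) (snd p)) i * h (fst (snd p i)))"
  have hf: "(\<lambda>z :: (real ^ 'd) \<times> real. h (fst z)) \<in> borel_measurable borel"
    by (rule measurable_compose[OF fst_measurable h(1)])
  have "(\<integral>\<^sup>+\<omega>. ?F (\<Theta> \<omega>, V n \<omega>) \<partial>M) \<le> 2 * (\<integral>\<^sup>+z. ennreal (h (fst z)) \<partial>P)"
  proof (rule nn_integral_forest_le)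
    show "?F \<in> borel_measurable (sample_space n)"
      using measurable_weighted_sum[OF hf] by measurable
    show "?F (\<theta>, D(n := (x, y))) = ?F (\<theta>, D(n := (x, 0)))" for \<theta> D x y
      by (simp add: leaf_paths_upd cong: sum.cong_simp)
    fix \<theta> assume \<theta>: "\<theta> \<in> space N"
    show "(\<integral>\<^sup>+D. ?F (\<theta>, D) \<partial>PiM {..n} (\<lambda>_. P)) \<le> 2 * (\<integral>\<^sup>+z. ennreal (h (fst z)) \<partial>P)"
      using labelled_sample.nn_integral_weighted_mean_le[OF labelled_sample_path[OF \<theta>, of n], of "\<lambda>z. h (fst z)" n] hf h(2)
      by (simp add: lab_eq_leaf_paths[OF \<theta>] sets_P cong: measurable_cong_sets)
  qed
  moreover have "(\<integral>\<^sup>+z. ennreal (h (fst z)) \<partial>P) = (\<integral>\<^sup>+\<omega>. ennreal (h (X \<omega>)) \<partial>M)"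
    unfolding P_def by (subst nn_integral_distr) (use hf in auto)
  ultimately show ?thesis by simp
qed

lemma missing_weight_le:
  "(\<integral>\<^sup>+\<omega>. ennreal (1 - (\<Sum>i<n. weight n (leaf_paths n (\<Theta> \<omega>) (V n \<omega>)) i)) \<partial>M) \<le> ennreal (2 ^ k n / real (n + 1))"
proof -
  let ?F = "\<lambda>p. ennreal (1 - (\<Sum>i<n. weight n (leaf_paths n (fst p) (snd p)) i))"
  have "(\<integral>\<^sup>+\<omega>. ?F (\<Theta> \<omega>, V n \<omega>) \<partial>M) \<le> ennreal (2 ^ k n / real (n + 1))"
  proof (rule nn_integral_forest_le)
    show "?F \<in> borel_measurable (sample_space n)"
      using measurable_weighted_sum[of "\<lambda>_. 1" n] by simp
    show "?F (\<theta>, D(n := (x, y))) = ?F (\<theta>, D(n := (x, 0)))" for \<theta> D x y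
      by (simp add: leaf_paths_upd)
    fix \<theta> assume \<theta>: "\<theta> \<in> space N"
    show "(\<integral>\<^sup>+D. ?F (\<theta>, D) \<partial>PiM {..n} (\<lambda>_. P)) \<le> ennreal (2 ^ k n / real (n + 1))"
      using labelled_sample.nn_integral_missing_weight_le[OF labelled_sample_path[OF \<theta>, of n], of n]
      by (simp add: lab_eq_leaf_paths[OF \<theta>] card_bool_lists)
  qed
  then show ?thesis by simp
qed

text \<open>The cell lies in the cube and is therefore bounded, so its diameter really bounds the
  distances in it.\<close>

lemma dist_le_diameter_leaf_cell:
  assumes \<omega>: "\<omega> \<in> space M" and i: "i < n" and eq: "leaf_paths n \<theta> (V n \<omega>) i = leaf_paths n \<theta> (V n \<omega>) n"
  shows "dist (fst (Z i \<omega>)) (X \<omega>) \<le> diameter (leaf_cell (T n \<theta>) (X \<omega>))"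
proof (rule diameter_bounded_bound)
  have "leaf_cell (T n \<theta>) (X \<omega>) \<subseteq> cbox 0 1" by (auto simp: mem_leaf_cell_iff)
  then show "bounded (leaf_cell (T n \<theta>) (X \<omega>))" by (rule bounded_subset[OF bounded_cbox])
  show "fst (Z i \<omega>) \<in> leaf_cell (T n \<theta>) (X \<omega>)" "X \<omega> \<in> leaf_cell (T n \<theta>) (X \<omega>)"
    using eq i X_cube[OF \<omega>] Z_cube[OF \<omega>] by (simp_all add: mem_leaf_cell_iff leaf_paths_def)
qed

lemma measurable_parameter_sample:
  assumes "F \<in> borel_measurable (sample_space n)"
  shows "(\<lambda>\<omega>. F (\<Theta> \<omega>, V n \<omega>)) \<in> borel_measurable M"
  by (rule measurable_compose[OF _ assms]) measurable

text \<open>The five summands bound, in this order, the averaged noise, the average of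
  \<open>m - g\<close>, the oscillation of \<open>g\<close> on the cell with the failure of
  \<open>A\<close>, the empty cell, and the approximation error at the query.\<close>

lemma forest_risk_bound:
  assumes g [measurable]: "g \<in> borel_measurable borel" and gL: "\<And>x. \<bar>g x\<bar> \<le> L"
    and unif: "\<And>x z. x \<in> cbox 0 1 \<Longrightarrow> z \<in> cbox 0 1 \<Longrightarrow> dist z x \<le> \<delta> \<Longrightarrow> \<bar>g z - g x\<bar> \<le> \<eta>"
    and A [measurable]: "A \<in> sets M"
    and good: "\<And>\<omega>. \<omega> \<in> A \<Longrightarrow> diameter (leaf_cell (T n (\<Theta> \<omega>)) (X \<omega>)) \<le> \<delta>"
    and L': "0 \<le> L'"
  shows "forest_risk M \<Theta> T Z X m n \<le> 5 *
    ((ennreal (2 * L') * ennreal (2 ^ k n / real (n + 1)) + 2 * (\<integral>\<^sup>+z. ennreal (max 0 ((noise z)\<^sup>2 - L')) \<partial>P)) +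
     2 * (\<integral>\<^sup>+\<omega>. ennreal ((m (X \<omega>) - g (X \<omega>))\<^sup>2) \<partial>M) +
     (ennreal (\<eta>\<^sup>2) + ennreal (4 * L\<^sup>2) * emeasure M (space M - A)) +
     ennreal (L\<^sup>2) * ennreal (2 ^ k n / real (n + 1)) +
     (\<integral>\<^sup>+\<omega>. ennreal ((m (X \<omega>) - g (X \<omega>))\<^sup>2) \<partial>M))"
proof -
  let ?w = "\<lambda>\<omega>. weight n (leaf_paths n (\<Theta> \<omega>) (V n \<omega>))"
  let ?a = "\<lambda>\<omega>. (\<Sum>i<n. ?w \<omega> i * noise (V n \<omega> i))\<^sup>2"
  let ?b = "\<lambda>\<omega>. \<Sum>i<n. ?w \<omega> i * (m (fst (V n \<omega> i)) - g (fst (V n \<omega> i)))\<^sup>2"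
  let ?c = "\<lambda>\<omega>. \<eta>\<^sup>2 + 4 * L\<^sup>2 * of_bool (\<omega> \<notin> A)"
  let ?d = "\<lambda>\<omega>. 1 - (\<Sum>i<n. ?w \<omega> i)"
  let ?e = "\<lambda>\<omega>. (m (X \<omega>) - g (X \<omega>))\<^sup>2"
  have h: "(\<lambda>x. (m x - g x)\<^sup>2) \<in> borel_measurable borel" by measurable
  have hf: "(\<lambda>z :: (real ^ 'd) \<times> real. (m (fst z) - g (fst z))\<^sup>2) \<in> borel_measurable borel"
    by (rule measurable_compose[OF fst_measurable h])
  have a_meas [measurable]: "?a \<in> borel_measurable M"
    using measurable_parameter_sample[OF measurable_weighted_sum[OF noise_measurable]] by simp
  have b_meas [measurable]: "?b \<in> borel_measurable M"
    using measurable_parameter_sample[OF measurable_weighted_sum[OF hf]] by simp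
  have d_meas [measurable]: "?d \<in> borel_measurable M"
    using measurable_parameter_sample[OF measurable_weighted_sum[of "\<lambda>_. 1" n]] by simp
  have b0: "0 \<le> ?b \<omega>" for \<omega> by (intro sum_nonneg) simp
  have d0: "0 \<le> ?d \<omega>" for \<omega> by (simp add: sum_weight)
  have pointwise: "ennreal ((est n (\<Theta> \<omega>) (V n \<omega>) - m (X \<omega>))\<^sup>2) \<le> 5 * (ennreal (?a \<omega>) + ennreal (?b \<omega>) +
      (ennreal (\<eta>\<^sup>2) + ennreal (4 * L\<^sup>2) * indicator (space M - A) \<omega>) + ennreal (L\<^sup>2) * ennreal (?d \<omega>) + ennreal (?e \<omega>))"
    if \<omega>: "\<omega> \<in> space M" for \<omega>
  proof -
    have "((\<Sum>i<n. ?w \<omega> i * snd (V n \<omega> i)) - m (fst (V n \<omega> n)))\<^sup>2 \<le>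
      5 * (?a \<omega> + (\<Sum>i<n. ?w \<omega> i * (m (fst (V n \<omega> i)) - g (fst (V n \<omega> i)))\<^sup>2) +
        (\<eta>\<^sup>2 + 4 * L\<^sup>2 * of_bool (\<not> \<omega> \<in> A)) + L\<^sup>2 * ?d \<omega> + (m (fst (V n \<omega> n)) - g (fst (V n \<omega> n)))\<^sup>2)"
    proof (rule weighted_estimate_error_le)
      fix i assume i: "i < n" and eq: "leaf_paths n (\<Theta> \<omega>) (V n \<omega>) i = leaf_paths n (\<Theta> \<omega>) (V n \<omega>) n" and "\<omega> \<in> A"
      then show "\<bar>g (fst (V n \<omega> i)) - g (fst (V n \<omega> n))\<bar> \<le> \<eta>"
        using dist_le_diameter_leaf_cell[OF \<omega> i eq] good[of \<omega>] unif[OF X_cube[OF \<omega>] Z_cube[OF \<omega>]]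
        by (simp add: order_trans)
    qed (auto simp: noise_def gL)
    then have "(est n (\<Theta> \<omega>) (V n \<omega>) - m (X \<omega>))\<^sup>2 \<le> 5 * (?a \<omega> + ?b \<omega> + ?c \<omega> + L\<^sup>2 * ?d \<omega> + ?e \<omega>)"
      by (simp add: est_def)
    then have "ennreal ((est n (\<Theta> \<omega>) (V n \<omega>) - m (X \<omega>))\<^sup>2) \<le> ennreal (5 * (?a \<omega> + ?b \<omega> + ?c \<omega> + L\<^sup>2 * ?d \<omega> + ?e \<omega>))"
      by (rule ennreal_leI)
    also have "\<dots> = 5 * (ennreal (?a \<omega>) + ennreal (?b \<omega>) + ennreal (?c \<omega>) + ennreal (L\<^sup>2 * ?d \<omega>) + ennreal (?e \<omega>))"
      using b0[of \<omega>] d0[of \<omega>] by (simp add: ennreal_mult ennreal_plus del: ennreal_plus_if)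
    also have "ennreal (?c \<omega>) = ennreal (\<eta>\<^sup>2) + ennreal (4 * L\<^sup>2) * indicator (space M - A) \<omega>"
      using \<omega> by (simp add: ennreal_plus indicator_def)
    also have "ennreal (L\<^sup>2 * ?d \<omega>) = ennreal (L\<^sup>2) * ennreal (?d \<omega>)"
      using d0[of \<omega>] by (intro ennreal_mult) auto
    finally show ?thesis .
  qed
  have "forest_risk M \<Theta> T Z X m n \<le> (\<integral>\<^sup>+\<omega>. ennreal ((est n (\<Theta> \<omega>) (V n \<omega>) - m (X \<omega>))\<^sup>2) \<partial>M)"
    by (rule forest_risk_le)
  also have "\<dots> \<le> (\<integral>\<^sup>+\<omega>. 5 * (ennreal (?a \<omega>) + ennreal (?b \<omega>) +
      (ennreal (\<eta>\<^sup>2) + ennreal (4 * L\<^sup>2) * indicator (space M - A) \<omega>) + ennreal (L\<^sup>2) * ennreal (?d \<omega>) + ennreal (?e \<omega>)) \<partial>M)"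
    by (rule nn_integral_mono) (rule pointwise)
  also have "\<dots> = 5 * ((\<integral>\<^sup>+\<omega>. ennreal (?a \<omega>) \<partial>M) + (\<integral>\<^sup>+\<omega>. ennreal (?b \<omega>) \<partial>M) +
      (ennreal (\<eta>\<^sup>2) + ennreal (4 * L\<^sup>2) * emeasure M (space M - A)) +
      ennreal (L\<^sup>2) * (\<integral>\<^sup>+\<omega>. ennreal (?d \<omega>) \<partial>M) + (\<integral>\<^sup>+\<omega>. ennreal (?e \<omega>) \<partial>M))"
  proof -
    have "(\<integral>\<^sup>+\<omega>. 5 * (f1 \<omega> + f2 \<omega> + (c1 + c2 * indicator B \<omega>) + c3 * f3 \<omega> + f4 \<omega>) \<partial>M) =
        5 * (integral\<^sup>N M f1 + integral\<^sup>N M f2 + (c1 + c2 * emeasure M B) + c3 * integral\<^sup>N M f3 + integral\<^sup>N M f4)"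
      if [measurable]: "f1 \<in> borel_measurable M" "f2 \<in> borel_measurable M" "f3 \<in> borel_measurable M"
        "f4 \<in> borel_measurable M" "B \<in> sets M"
      for f1 f2 f3 f4 :: "'w \<Rightarrow> ennreal" and c1 c2 c3 B
      by (simp add: nn_integral_cmult nn_integral_add emeasure_space_1 del: distrib_left_numeral)
    note linear = this
    show ?thesis
    proof (rule linear)
      show "(\<lambda>\<omega>. ennreal (?a \<omega>)) \<in> borel_measurable M" using a_meas by (rule measurable_compose_rev[OF measurable_ennreal])
      show "(\<lambda>\<omega>. ennreal (?b \<omega>)) \<in> borel_measurable M" using b_meas by (rule measurable_compose_rev[OF measurable_ennreal])
      show "(\<lambda>\<omega>. ennreal (?d \<omega>)) \<in> borel_measurable M" using d_meas by (rule measurable_compose_rev[OF measurable_ennreal])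
    qed measurable
  qed
  also have "\<dots> \<le> 5 *
    ((ennreal (2 * L') * ennreal (2 ^ k n / real (n + 1)) + 2 * (\<integral>\<^sup>+z. ennreal (max 0 ((noise z)\<^sup>2 - L')) \<partial>P)) +
     2 * (\<integral>\<^sup>+\<omega>. ennreal (?e \<omega>) \<partial>M) +
     (ennreal (\<eta>\<^sup>2) + ennreal (4 * L\<^sup>2) * emeasure M (space M - A)) +
     ennreal (L\<^sup>2) * ennreal (2 ^ k n / real (n + 1)) + (\<integral>\<^sup>+\<omega>. ennreal (?e \<omega>) \<partial>M))"
    by (intro mult_left_mono add_mono order_refl noise_le[OF L'] missing_weight_le
        approximation_le[OF h, of n]) auto
  finally show ?thesis .
qed

text \<open>
  A nonmeasurable set has measure \<open>0\<close>, so a positive lower bound on the measure of the event of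
  small diameters also makes this event measurable.
\<close>

lemma forest_risk_tendsto_0:
  assumes diam: "\<And>\<rho> \<epsilon> :: real. \<rho> > 0 \<Longrightarrow> \<epsilon> > 0 \<Longrightarrow>
       \<exists>N>0::nat. measure M {\<omega> \<in> space M. \<forall>n>N. diameter (leaf_cell (T n (\<Theta> \<omega>)) (X \<omega>)) \<le> \<epsilon>} \<ge> 1 - \<rho>"
    and kn: "(\<lambda>n. 2 ^ k n / real n) \<longlonglongrightarrow> 0"
  shows "forest_risk M \<Theta> T Z X m \<longlonglongrightarrow> 0"
proof (rule order_tendstoI)
  fix a :: ennreal assume "0 < a"
  obtain e where e: "0 < e" "ennreal e \<le> a"
  proof (cases a)
    case (real r)
    then show ?thesis using that[of r] \<open>0 < a\<close> by (simp add: ennreal_0 zero_less_iff_neq_zero)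
  next
    case top
    then show ?thesis using that[of 1] by simp
  qed
  \<comment> \<open>The final bound is 5 times nine portions of size \<open>q\<close>, that is 45 q
    < 50 q = e.\<close>
  define q where "q = e / 50"
  have q: "0 < q" using e by (simp add: q_def)
  let ?\<mu> = "distr M borel X"
  interpret \<mu>: prob_space ?\<mu> by (rule prob_space_distr) measurable
  obtain g L where g: "continuous_on UNIV g" "0 < L" "\<And>x. \<bar>g x\<bar> \<le> L"
    "(\<integral>\<^sup>+x. ennreal ((m x - g x)\<^sup>2) \<partial>?\<mu>) < ennreal q"
  proof (rule l2_continuous_approximation)
    show "finite_measure ?\<mu>" by unfold_locales
    show "integrable ?\<mu> (\<lambda>x. (m x)\<^sup>2)" using m_square by (subst integrable_distr_eq) auto
  qed (use q in auto)
  have [measurable]: "g \<in> borel_measurable borel" by (rule borel_measurable_continuous_onI[OF g(1)])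
  have gm: "(\<integral>\<^sup>+\<omega>. ennreal ((m (X \<omega>) - g (X \<omega>))\<^sup>2) \<partial>M) \<le> ennreal q"
    using g(4) by (subst (asm) nn_integral_distr) auto
  obtain L' where L': "0 \<le> L'" "(\<integral>\<^sup>+z. ennreal (max 0 ((noise z)\<^sup>2 - L')) \<partial>P) \<le> ennreal q"
    by (rule square_tail_small[OF _ noise_square q]) measurable
  have "uniformly_continuous_on (cbox 0 1) g"
    by (intro compact_uniformly_continuous continuous_on_subset[OF g(1)] compact_cbox) auto
  \<comment> \<open>An oscillation of \<open>sqrt q\<close> contributes exactly \<open>q\<close>
    after squaring.\<close>
  then obtain d where d: "0 < d" "\<And>x z. x \<in> cbox 0 1 \<Longrightarrow> z \<in> cbox 0 1 \<Longrightarrow> dist z x < d \<Longrightarrow> dist (g z) (g x) < sqrt q"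
    unfolding uniformly_continuous_on_def using q by (metis real_sqrt_gt_0_iff)
  \<comment> \<open>The bound 1/2 keeps 1 - \<rho> positive, so that \<open>A\<close> has positive
    measure; the other bound makes the bad event cost at most \<open>q\<close>.\<close>
  define \<rho> where "\<rho> = min (1 / 2) (q / (4 * L\<^sup>2))"
  have \<rho>: "0 < \<rho>" "\<rho> < 1" "4 * L\<^sup>2 * \<rho> \<le> q"
    using q g(2) by (auto simp: \<rho>_def min_def field_simps)
  \<comment> \<open>Half of \<open>d\<close>, because diameters are controlled by a weak inequality
    and uniform continuity asks for a strict one.\<close>
  obtain n0 where n0: "measure M {\<omega> \<in> space M. \<forall>n>n0. diameter (leaf_cell (T n (\<Theta> \<omega>)) (X \<omega>)) \<le> d / 2} \<ge> 1 - \<rho>"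
    using diam[of \<rho> "d / 2"] \<rho> d(1) by auto
  define A where "A = {\<omega> \<in> space M. \<forall>n>n0. diameter (leaf_cell (T n (\<Theta> \<omega>)) (X \<omega>)) \<le> d / 2}"
  have "measure M A \<noteq> 0" using n0 \<rho> by (simp add: A_def)
  then have A: "A \<in> sets M" using measure_notin_sets by blast
  have "emeasure M (space M - A) = ennreal (1 - measure M A)"
    using A by (simp add: emeasure_eq_measure prob_compl)
  also have "\<dots> \<le> ennreal \<rho>" using n0 by (intro ennreal_leI) (simp add: A_def)
  finally have "ennreal (4 * L\<^sup>2) * emeasure M (space M - A) \<le> ennreal (4 * L\<^sup>2) * ennreal \<rho>"
    by (intro mult_left_mono) auto
  also have "\<dots> \<le> ennreal q" using \<rho> by (simp add: ennreal_mult[symmetric] ennreal_leI)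
  finally have bad: "ennreal (4 * L\<^sup>2) * emeasure M (space M - A) \<le> ennreal q" .
  \<comment> \<open>One threshold serves the noise, with coefficient 2 L', and the empty cell, with
    coefficient L^2: both coefficients are at most the denominator.\<close>
  define c where "c = q / (2 * L' + L\<^sup>2)"
  have c_pos: "0 < 2 * L' + L\<^sup>2" using L'(1) g(2) by (simp add: add_nonneg_pos)
  then have c: "0 < c" using q by (simp add: c_def)
  have c_le: "B * c \<le> q" if "B \<le> 2 * L' + L\<^sup>2" for B
  proof -
    have "B * c \<le> (2 * L' + L\<^sup>2) * c" using that c by (intro mult_right_mono) auto
    then show ?thesis using c_pos by (simp add: c_def)
  qed
  have "\<forall>\<^sub>F n in sequentially. 2 ^ k n / real n < c" by (rule order_tendstoD(2)[OF kn c])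
  then show "\<forall>\<^sub>F n in sequentially. forest_risk M \<Theta> T Z X m n < a"
    using eventually_gt_at_top[of n0] eventually_gt_at_top[of 0]
  proof eventually_elim
    case (elim n)
    have "2 ^ k n / real (n + 1) \<le> (2 ^ k n / real n :: real)"
      using elim(3) by (intro divide_left_mono) auto
    then have K: "2 ^ k n / real (n + 1) \<le> c" using elim(1) by linarith
    have small: "ennreal B * ennreal (2 ^ k n / real (n + 1)) \<le> ennreal q" if B: "0 \<le> B" "B \<le> 2 * L' + L\<^sup>2" for B
    proof -
      have "B * (2 ^ k n / real (n + 1)) \<le> q"
        using mult_left_mono[OF K B(1)] c_le[OF B(2)] by linarith
      then show ?thesis using B by (subst ennreal_mult[symmetric]) (auto intro: ennreal_leI)
    qed
    have "forest_risk M \<Theta> T Z X m n \<le> 5 *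
      ((ennreal (2 * L') * ennreal (2 ^ k n / real (n + 1)) + 2 * (\<integral>\<^sup>+z. ennreal (max 0 ((noise z)\<^sup>2 - L')) \<partial>P)) +
       2 * (\<integral>\<^sup>+\<omega>. ennreal ((m (X \<omega>) - g (X \<omega>))\<^sup>2) \<partial>M) +
       (ennreal ((sqrt q)\<^sup>2) + ennreal (4 * L\<^sup>2) * emeasure M (space M - A)) +
       ennreal (L\<^sup>2) * ennreal (2 ^ k n / real (n + 1)) +
       (\<integral>\<^sup>+\<omega>. ennreal ((m (X \<omega>) - g (X \<omega>))\<^sup>2) \<partial>M))"
    proof (rule forest_risk_bound[where \<delta>="d / 2", OF _ g(3) _ A _ L'(1)])
      fix x z :: "real ^ 'd" assume "x \<in> cbox 0 1" "z \<in> cbox 0 1" "dist z x \<le> d / 2"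
      then show "\<bar>g z - g x\<bar> \<le> sqrt q" using d(1) d(2)[of x z] by (simp add: dist_real_def)
    next
      fix \<omega> assume "\<omega> \<in> A"
      then show "diameter (leaf_cell (T n (\<Theta> \<omega>)) (X \<omega>)) \<le> d / 2" using elim(2) by (simp add: A_def)
    qed measurable
    also have "\<dots> \<le> 5 * ((ennreal q + 2 * ennreal q) + 2 * ennreal q + (ennreal q + ennreal q) + ennreal q + ennreal q)"
      using q L'(1) by (intro mult_left_mono add_mono small L'(2) gm bad) auto
    also have "\<dots> = ennreal (45 * q)"
    proof -
      have 2: "2 * ennreal q = ennreal (2 * q)" using q by (simp add: ennreal_mult)
      have 5: "5 * ennreal x = ennreal (5 * x)" if "0 \<le> x" for x using that by (simp add: ennreal_mult)
      show ?thesis using q by (simp add: 2 5 ennreal_plus[symmetric] del: ennreal_plus)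
    qed
    also have "\<dots> < ennreal e" using e by (intro ennreal_lessI) (auto simp: q_def)
    finally show "forest_risk M \<Theta> T Z X m n < a" using e(2) by simp
  qed
qed simp

end

theorem theorem4p1:
  fixes M :: "'w measure"
    and X :: "'w \<Rightarrow> real ^ 'd::finite" and Y :: "'w \<Rightarrow> real"
    and Z :: "nat \<Rightarrow> 'w \<Rightarrow> (real ^ 'd) \<times> real"
    and N\<^sub>\<Theta> :: "'t measure" and \<Theta> :: "'w \<Rightarrow> 't"
    and T :: "nat \<Rightarrow> 't \<Rightarrow> 'd cut_tree"
    and k :: "nat \<Rightarrow> nat" and m :: "real ^ 'd \<Rightarrow> real"
  assumes "prob_space M"
    and "X \<in> borel_measurable M" and "Y \<in> borel_measurable M"
    and "\<And>i. Z i \<in> borel_measurable M" and "\<Theta> \<in> measurable M N\<^sub>\<Theta>"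
    and "\<And>\<omega>. \<omega> \<in> space M \<Longrightarrow> X \<omega> \<in> cbox 0 1"
    and "\<And>i \<omega>. \<omega> \<in> space M \<Longrightarrow> fst (Z i \<omega>) \<in> cbox 0 1"
    and "integrable M (\<lambda>\<omega>. (Y \<omega>)\<^sup>2)"
    and "\<And>i. distr M borel (Z i) = distr M borel (\<lambda>\<omega>. (X \<omega>, Y \<omega>))"
    and "independent_sources M Z X N\<^sub>\<Theta> \<Theta>"
    and "regression_function M X Y m"
    and "totally_non_adaptive N\<^sub>\<Theta> T k"
    and "\<And>\<rho> \<epsilon> :: real. \<rho> > 0 \<Longrightarrow> \<epsilon> > 0 \<Longrightarrow>
           \<exists>N>0::nat. measure M {\<omega> \<in> space M. \<forall>n>N. diameter (leaf_cell (T n (\<Theta> \<omega>)) (X \<omega>)) \<le> \<epsilon>} \<ge> 1 - \<rho>"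
    and "filterlim k at_top sequentially"
    and "(\<lambda>n. 2 ^ k n / real n) \<longlonglongrightarrow> 0"
  shows "forest_risk M \<Theta> T Z X m \<longlonglongrightarrow> 0"
proof -
  interpret non_adaptive_forest M X Y Z N\<^sub>\<Theta> \<Theta> T k m
    using assms(1-12)
    by (intro non_adaptive_forest.intro random_sample.intro
        random_sample_axioms.intro non_adaptive_forest_axioms.intro)
  show ?thesis by (rule forest_risk_tendsto_0[OF assms(13,15)])
qed

end
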